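(* Let $m\in\mathbb{N}$. Suppose $a\ge 0$ and $c\in\mathbb{R}$ are such that for every $u\in H^1(\mathbb{S}^2)$ with $\int_{\mathbb{S}^2}u\,d\mu=0$ and $\int_{\mathbb{S}^2}p\,e^{2u}\,d\mu=0$ for every $p\in\overset{\circ}{\mathcal{P}}_m$, one has $$\log\int_{\mathbb{S}^2}e^{2u}\,d\mu\le a\|\nabla u\|_{L^2(\mathbb{S}^2)}^2+c .$$ Then $a\ge\frac{1}{4\pi N_m}$.
   Context: $\mathbb{N}$ denotes the positive integers. $\mathbb{S}^2\subset\mathbb{R}^3$ is the unit sphere with its standard round metric and $\mu$ is its standard area measure (total mass $4\pi$). $H^1(\mathbb{S}^2)$ is the Sobolev space of real-valued $L^2$ functions with weak gradient in $L^2$. For a nonnegative integer $k$, $\mathcal{P}_k$ is the set of all (real) polynomials on $\mathbb{R}^3$ of degree at most $k$, and $\overset{\circ}{\mathcal{P}}_k=\{p\in\mathcal{P}_k:\int_{\mathbb{S}^2}p\,d\mu=0\}$. For $m\in\mathbb{N}$, $\mathcal{N}_m$ is the set of all $N\in\mathbb{N}$ for which there exist points $x_1,\dots,x_N\in\mathbb{S}^2$ and weights $\nu_1,\dots,\nu_N\in[0,\infty)$ with $\nu_1+\cdots+\nu_N=1$ such that $\nu_1p(x_1)+\cdots+\nu_Np(x_N)=0$ for all $p\in\overset{\circ}{\mathcal{P}}_m$. (Equivalently, $\nu_1p(x_1)+\cdots+\nu_Np(x_N)=\frac{1}{4\pi}\int_{\mathbb{S}^2}p\,d\mu$ for all $p\in\mathcal{P}_m$.)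 $N_m=\min\mathcal{N}_m$ is the smallest element of $\mathcal{N}_m$. *)

theory Defs
  imports "HOL-Analysis.Analysis"
begin

section \<open>The area measure of the unit sphere\<close>

text \<open>The area of a Borel set \<open>A\<close> of the unit sphere is three times the volume of the cone
  \<open>{t x. x \<in> A, 0 < t \<le> 1}\<close> over \<open>A\<close> (integration in polar coordinates). It is the only
  rotation invariant measure of total mass \<open>4 pi\<close>; both properties are proved below.\<close>

definition S2 :: "(real^3) measure" where
  "S2 = scale_measure 3
     (distr (restrict_space lborel (cball 0 1 - {0})) (restrict_space borel (sphere 0 1)) sgn)"

lemma space_S2 [simp]: "space S2 = sphere 0 1"
  by (simp add: S2_def space_scale_measure space_restrict_space)

lemma sets_S2 [simp, measurable_cong]: "sets S2 = sets (restrict_space borel (sphere 0 1))"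
  by (simp add: S2_def)

lemma sgn_measurable_sphere:
  "sgn \<in> measurable (restrict_space lborel (cball 0 1 - {0})) (restrict_space borel (sphere (0::real^3) 1))"
  by (rule measurable_restrict_space2) (auto simp: space_restrict_space norm_sgn intro!: measurable_restrict_space1)

lemma emeasure_S2:
  assumes "A \<in> sets S2"
  shows "emeasure S2 A = 3 * emeasure lborel {y \<in> cball 0 1 - {0}. sgn y \<in> A}"
proof -
  have A: "A \<in> sets (restrict_space borel (sphere 0 1))" using assms by simp
  have "emeasure S2 A = 3 * emeasure (restrict_space lborel (cball 0 1 - {0}))
      (sgn -` A \<inter> (cball 0 1 - {0}))"
    using emeasure_distr[OF sgn_measurable_sphere A]
    by (simp add: S2_def space_restrict_space)
  also have "\<dots> = 3 * emeasure lborel (sgn -` A \<inter> (cball 0 1 - {0}))"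
    by (subst emeasure_restrict_space) auto
  also have "sgn -` A \<inter> (cball 0 1 - {0}) = {y \<in> cball 0 1 - {0}. sgn y \<in> A}" by auto
  finally show ?thesis .
qed

lemma emeasure_S2_total: "emeasure S2 (sphere 0 1) = ennreal (4 * pi)"
proof -
  have "{y \<in> cball 0 1 - {0}. sgn y \<in> sphere (0::real^3) 1} = cball 0 1 - {0}"
    by (auto simp: norm_sgn)
  moreover have "sphere 0 1 \<in> sets S2"
    using sets.top[of S2] by simp
  moreover have "emeasure lborel (cball (0::real^3) 1 - {0}) = ennreal (4/3 * pi)"
    by (subst emeasure_Diff) (auto simp: emeasure_cball unit_ball_vol_3)
  ultimately show ?thesis
    by (simp add: emeasure_S2 flip: ennreal_numeral ennreal_mult)
qed

lemma distr_S2_rotation: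
  assumes f: "orthogonal_transformation f"
  shows "distr S2 S2 f = S2"
proof (rule measure_eqI)
  have nf: "norm (f x) = norm x" for x using f by (rule orthogonal_transformation_norm)
  have lin: "linear f" using f by (rule orthogonal_transformation_linear)
  have fb: "f \<in> borel_measurable borel"
    using lin by (intro borel_measurable_continuous_onI linear_continuous_on linear_conv_bounded_linear[THEN iffD1])
  have fm: "f \<in> measurable S2 S2"
    unfolding measurable_cong_sets[OF sets_S2 sets_S2]
    by (rule measurable_restrict_space2)
      (auto simp: space_restrict_space nf intro!: measurable_restrict_space1 fb)
  fix A assume "A \<in> sets (distr S2 S2 f)"
  then have A: "A \<in> sets S2" by simp
  define B where "B = {y \<in> cball 0 1 - {0}. sgn y \<in> A}"
  have fA: "f -` A \<inter> sphere 0 1 \<in> sets S2"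
    using measurable_sets[OF fm A] by simp
  have f0: "f y = 0 \<longleftrightarrow> y = 0" for y
    using nf[of y] by (metis norm_eq_zero)
  have sgnf: "sgn (f y) = f (sgn y)" for y
    using lin by (simp add: sgn_div_norm nf linear_cmul)
  have pre: "{y \<in> cball 0 1 - {0}. sgn y \<in> f -` A \<inter> sphere 0 1} = f -` B"
    by (auto simp: B_def sgnf nf norm_sgn f0)
  have Bs: "B \<in> sets borel"
  proof -
    have "sgn -` A \<inter> (cball 0 1 - {0}) \<in> sets (restrict_space lborel (cball 0 1 - {0}))"
      using measurable_sets[OF sgn_measurable_sphere, of A] A by (simp add: space_restrict_space)
    then have "sgn -` A \<inter> (cball 0 1 - {0}) \<in> sets borel"
      by (subst (asm) sets_restrict_space_iff) auto
    moreover have "sgn -` A \<inter> (cball 0 1 - {0}) = B" by (auto simp: B_def)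
    ultimately show ?thesis by simp
  qed
  have bij: "bij f" using f by (simp add: orthogonal_transformation_bij)
  have img: "f ` (f -` B) = B" using bij by (simp add: bij_def surj_image_vimage_eq)
  have fBs: "f -` B \<in> sets borel" using measurable_sets[OF fb Bs] by simp
  have fBm: "f -` B \<in> lmeasurable"
  proof (rule bounded_set_imp_lmeasurable)
    show "bounded (f -` B)" by (rule bounded_subset[of "cball 0 1"]) (auto simp: B_def nf)
    show "f -` B \<in> sets lebesgue" using fBs by simp
  qed
  have m: "measure lebesgue B = measure lebesgue (f -` B)"
    using measure_orthogonal_image[OF f fBm] img by simp
  have "B \<in> lmeasurable" using measurable_orthogonal_image[OF f fBm] img by simp
  with fBm m have "emeasure lebesgue B = emeasure lebesgue (f -` B)"
    by (simp add: emeasure_eq_measure2)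
  then have "emeasure lborel B = emeasure lborel (f -` B)"
    using Bs fBs by simp
  then show "emeasure (distr S2 S2 f) A = emeasure S2 A"
    unfolding emeasure_distr[OF fm A] space_S2 emeasure_S2[OF fA] emeasure_S2[OF A] pre
    by (simp only: B_def[symmetric])
qed simp


section \<open>The Sobolev space \<open>H\<^sup>1\<close> of the sphere\<close>

definition square_integrable_S2 :: "(real^3 \<Rightarrow> 'b::euclidean_space) \<Rightarrow> bool" where
  "square_integrable_S2 f \<longleftrightarrow>
     f \<in> borel_measurable S2 \<and> integrable S2 (\<lambda>x. (norm (f x))\<^sup>2)"

definition L2_norm_S2 :: "(real^3 \<Rightarrow> 'b::euclidean_space) \<Rightarrow> real" where
  "L2_norm_S2 f = sqrt (LINT x|S2. (norm (f x))\<^sup>2)"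

primrec cont_diff :: "nat \<Rightarrow> ('a::euclidean_space \<Rightarrow> 'b::euclidean_space) \<Rightarrow> bool" where
  "cont_diff 0 f \<longleftrightarrow> continuous_on UNIV f"
| "cont_diff (Suc k) f \<longleftrightarrow>
     (\<exists>f'. (\<forall>x. (f has_derivative f' x) (at x)) \<and> (\<forall>v. cont_diff k (\<lambda>x. f' x v)))"

text \<open>Smooth tangent vector fields on the sphere are represented by smooth extensions to the
  whole space; every smooth field on the sphere has one.\<close>

definition smooth_tangent_field :: "(real^3 \<Rightarrow> real^3) \<Rightarrow> bool" where
  "smooth_tangent_field X \<longleftrightarrow> (\<forall>k. cont_diff k X) \<and> (\<forall>x\<in>sphere 0 1. X x \<bullet> x = 0)"

text \<open>The Riemannian divergence of a tangent field \<open>X\<close> at a point \<open>x\<close> of the sphere is the trace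
  of \<open>DX(x)\<close> restricted to the tangent plane, that is, the full trace minus the contribution of
  the unit normal \<open>x\<close>. On the sphere it does not depend on the extension of \<open>X\<close>.\<close>

definition div_S2 :: "(real^3 \<Rightarrow> real^3) \<Rightarrow> real^3 \<Rightarrow> real" where
  "div_S2 X x = (\<Sum>b\<in>Basis. frechet_derivative X (at x) b \<bullet> b) - frechet_derivative X (at x) x \<bullet> x"

text \<open>\<open>G\<close> is the (almost everywhere unique) weak gradient of \<open>u\<close>, and it is in \<open>L\<^sup>2\<close>.\<close>

definition has_L2_weak_gradient :: "(real^3 \<Rightarrow> real) \<Rightarrow> (real^3 \<Rightarrow> real^3) \<Rightarrow> bool"
    (infix "has'_L2'_weak'_gradient" 50) where
  "u has_L2_weak_gradient G \<longleftrightarrow>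
     square_integrable_S2 G \<and> (AE x in S2. G x \<bullet> x = 0) \<and>
     (\<forall>X. smooth_tangent_field X \<longrightarrow>
        (LINT x|S2. u x * div_S2 X x) = - (LINT x|S2. G x \<bullet> X x))"

definition H1_S2 :: "(real^3 \<Rightarrow> real) set" where
  "H1_S2 = {u. square_integrable_S2 u \<and> (\<exists>G. u has_L2_weak_gradient G)}"


section \<open>Polynomials and cubature\<close>

definition poly_space :: "nat \<Rightarrow> (real^3 \<Rightarrow> real) set" where
  "poly_space k = {p. \<exists>c :: (3 \<Rightarrow> nat) \<Rightarrow> real.
     p = (\<lambda>x. \<Sum>\<alpha> | (\<Sum>i\<in>UNIV. \<alpha> i) \<le> k. c \<alpha> * (\<Prod>i\<in>UNIV. x $ i ^ \<alpha> i))}"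

lemma finite_multi_indices: "finite {\<alpha> :: 3 \<Rightarrow> nat. (\<Sum>i\<in>UNIV. \<alpha> i) \<le> k}"
proof (rule finite_subset)
  show "{\<alpha> :: 3 \<Rightarrow> nat. (\<Sum>i\<in>UNIV. \<alpha> i) \<le> k} \<subseteq> PiE UNIV (\<lambda>_. {..k})"
  proof
    fix \<alpha> :: "3 \<Rightarrow> nat" assume *: "\<alpha> \<in> {\<alpha>. (\<Sum>i\<in>UNIV. \<alpha> i) \<le> k}"
    have "\<alpha> i \<le> k" for i
      using member_le_sum[of i UNIV \<alpha>] * by simp
    then show "\<alpha> \<in> PiE UNIV (\<lambda>_. {..k})" by (auto simp: PiE_iff)
  qed
  show "finite (PiE (UNIV :: 3 set) (\<lambda>_. {..k}))"
    by (rule finite_PiE) simp_all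
qed

definition mean_zero_poly_space :: "nat \<Rightarrow> (real^3 \<Rightarrow> real) set" where
  "mean_zero_poly_space k = {p \<in> poly_space k. (LINT x|S2. p x) = 0}"

definition cubature_sizes :: "nat \<Rightarrow> nat set" where
  "cubature_sizes m = {N. N \<ge> 1 \<and>
     (\<exists>(x :: nat \<Rightarrow> real^3) (\<nu> :: nat \<Rightarrow> real).
        (\<forall>i\<in>{1..N}. x i \<in> sphere 0 1 \<and> \<nu> i \<ge> 0) \<and> (\<Sum>i=1..N. \<nu> i) = 1 \<and>
        (\<forall>p\<in>mean_zero_poly_space m. (\<Sum>i=1..N. \<nu> i * p (x i)) = 0))}"

definition min_cubature_size :: "nat \<Rightarrow> nat" where
  "min_cubature_size m = (LEAST N. N \<in> cubature_sizes m)"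

end

theory Submission
  imports Defs
begin

text \<open>
  Let \<open>x\<^sub>1, \<dots>, x\<^sub>N\<close> and \<open>\<nu>\<^sub>1, \<dots>, \<nu>\<^sub>N\<close> be a cubature rule with the minimal number of nodes. The inequality
  is tested on \<open>u = 1/2 ln F\<close> minus its mean, where \<open>F y = (\<Sum>i. \<nu>\<^sub>i / (d + 1 - y \<bullet> x\<^sub>i)\<^sup>2)\<close> is a sum of
  bumps that concentrate at the nodes as \<open>d\<close> tends to zero.

  The side conditions hold exactly, without any correction of \<open>F\<close>: convolution with a zonal
  kernel maps polynomials of degree at most \<open>m\<close> to polynomials of degree at most \<open>m\<close> and
  preserves mean zero, and the integral of \<open>p F\<close> is the cubature sum of the convolution of \<open>p\<close> with
  the bump (\<open>zonal_convolution_power\<close>, \<open>zonal_sum_cubature\<close>).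

  Three estimates remain. The integral of \<open>F\<close> is at least \<open>1 / d\<close> (\<open>integral_bump_sum_ge\<close>), and the
  mean of \<open>ln F\<close> is bounded above (\<open>integral_ln_bump_sum_le\<close>), so the left-hand side of the inequality
  is at least \<open>ln (1 / d) - O(1)\<close>. The gradient of \<open>u\<close> is a weighted mean of the gradients
  for the single bumps, hence its squared length is at most the sum of their squared lengths
  (\<open>norm_tangential_gradient_le\<close>), and the energy is at most \<open>4 \<pi> N ln (1 / d) + O(1)\<close>. Dividing by
  \<open>ln (1 / d)\<close> and letting \<open>d\<close> tend to zero gives \<open>1 \<le> 4 \<pi> N a\<close>.

  Three further facts support this. Integration by parts on the sphere follows from the
  invariance of the area under rotations (\<open>integral_S2_plane_field\<close>, \<open>has_L2_weak_gradient_smooth\<close>).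
  Integrals of functions of \<open>y \<bullet> e\<close> are reduced to the interval \<open>[-1, 1]\<close> by the hat-box theorem of
  Archimedes (\<open>integral_S2_zonal\<close>). Finally, the minimal number of nodes is attained because
  cubature rules with nonnegative weights exist for every degree (\<open>cubature_sizes_nonempty\<close>).
\<close>

section \<open>Integration over the sphere\<close>

interpretation S2: finite_measure S2
  by standard (simp add: emeasure_S2_total)

lemma integrable_S2_continuous:
  fixes f :: "real^3 \<Rightarrow> 'b::euclidean_space"
  assumes "continuous_on (sphere 0 1) f"
  shows "integrable S2 f"
proof -
  have "compact (f ` sphere 0 1)"
    using assms by (intro compact_continuous_image) auto
  then obtain B where B: "\<forall>y\<in>f ` sphere 0 1. norm y \<le> B"
    using compact_imp_bounded bounded_iff by metis
  show ?thesis
  proof (rule S2.integrable_const_bound[where B = B])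
    show "AE x in S2. norm (f x) \<le> B" using B by (intro AE_I2) auto
    show "f \<in> borel_measurable S2"
      using borel_measurable_continuous_on_restrict[OF assms]
      by (simp add: measurable_cong_sets[OF sets_S2])
  qed
qed

lemma measurable_S2_continuous:
  fixes f :: "real^3 \<Rightarrow> 'b::euclidean_space"
  assumes "continuous_on (sphere 0 1) f"
  shows "f \<in> borel_measurable S2"
  using integrable_S2_continuous[OF assms] by auto

lemma integral_S2_cong:
  fixes f g :: "real^3 \<Rightarrow> 'b::euclidean_space"
  assumes "\<And>x. norm x = 1 \<Longrightarrow> f x = g x"
  shows "(LINT x|S2. f x) = (LINT x|S2. g x)"
  by (rule Bochner_Integration.integral_cong) (use assms in auto)

lemma integral_S2_mono:
  assumes "continuous_on (sphere 0 1) f" "continuous_on (sphere 0 1) g"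
    and "\<And>x. norm x = 1 \<Longrightarrow> f x \<le> (g x :: real)"
  shows "(LINT x|S2. f x) \<le> (LINT x|S2. g x)"
  by (rule integral_mono) (use assms in \<open>auto intro: integrable_S2_continuous\<close>)

lemma measure_S2_total [simp]: "measure S2 (sphere 0 1) = 4 * pi"
  by (simp add: measure_def emeasure_S2_total)

lemma integral_S2_rotation:
  fixes h :: "real^3 \<Rightarrow> real"
  assumes f: "orthogonal_transformation f" and h: "continuous_on (sphere 0 1) h"
  shows "(LINT x|S2. h (f x)) = (LINT x|S2. h x)"
proof -
  have nf: "norm (f x) = norm x" for x
    using f by (rule orthogonal_transformation_norm)
  have "f \<in> borel_measurable borel"
    using orthogonal_transformation_linear[OF f]
    by (intro borel_measurable_continuous_onI linear_continuous_on linear_conv_bounded_linear[THEN iffD1])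
  then have fm: "f \<in> measurable S2 S2"
    unfolding measurable_cong_sets[OF sets_S2 sets_S2]
    by (intro measurable_restrict_space2)
      (auto simp: space_restrict_space nf intro!: measurable_restrict_space1)
  have "(LINT x|S2. h x) = (LINT x|distr S2 S2 f. h x)"
    by (simp add: distr_S2_rotation[OF f])
  also have "\<dots> = (LINT x|S2. h (f x))"
    by (rule integral_distr[OF fm measurable_S2_continuous[OF h]])
  finally show ?thesis by simp
qed

section \<open>Infinitesimal rotations and weak gradients\<close>

text \<open>For an orthonormal pair \<open>a, b\<close>, this is the rotation by the angle \<open>s\<close> in the plane of \<open>a\<close> and \<open>b\<close>,
  from \<open>a\<close> towards \<open>b\<close>; the orthogonal complement of the plane is fixed.\<close>

definition plane_rotation :: "'a::euclidean_space \<Rightarrow> 'a \<Rightarrow> real \<Rightarrow> 'a \<Rightarrow> 'a" where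
  "plane_rotation a b s x =
     x + (cos s - 1) *\<^sub>R ((x \<bullet> a) *\<^sub>R a + (x \<bullet> b) *\<^sub>R b) + sin s *\<^sub>R ((x \<bullet> a) *\<^sub>R b - (x \<bullet> b) *\<^sub>R a)"

text \<open>The Killing field that generates the rotations of the plane of \<open>a\<close> and \<open>b\<close>.\<close>

definition plane_field :: "'a::euclidean_space \<Rightarrow> 'a \<Rightarrow> 'a \<Rightarrow> 'a" where
  "plane_field a b x = (x \<bullet> a) *\<^sub>R b - (x \<bullet> b) *\<^sub>R a"

lemma orthogonal_plane_rotation:
  assumes [simp]: "norm a = 1" "norm b = 1" "a \<bullet> b = 0"
  shows "orthogonal_transformation (plane_rotation a b s)"
  unfolding orthogonal_transformation
proof (intro conjI allI)
  show "linear (plane_rotation a b s)"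
    by (rule linearI) (simp_all add: plane_rotation_def algebra_simps)
  have [simp]: "a \<bullet> a = 1" "b \<bullet> b = 1" "b \<bullet> a = 0"
    by (simp_all add: norm_eq_1[symmetric] inner_commute[of b a])
  fix x
  define p q where "p = x \<bullet> a" and "q = x \<bullet> b"
  have [simp]: "a \<bullet> x = p" "b \<bullet> x = q" "x \<bullet> a = p" "x \<bullet> b = q"
    by (simp_all add: p_def q_def inner_commute)
  have "plane_rotation a b s x \<bullet> plane_rotation a b s x
      = x \<bullet> x + (p\<^sup>2 + q\<^sup>2) * ((sin s)\<^sup>2 + (cos s)\<^sup>2 - 1)"
    unfolding plane_rotation_def
    by (simp add: inner_simps del: sin_cos_squared_add sin_cos_squared_add2) algebra
  then show "norm (plane_rotation a b s x) = norm x"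
    by (simp add: norm_eq_sqrt_inner)
qed

lemma plane_rotation_0 [simp]: "plane_rotation a b 0 x = x"
  by (simp add: plane_rotation_def)

lemma plane_rotation_derivative:
  assumes "norm a = 1" "norm b = 1" "a \<bullet> b = 0"
  shows "((\<lambda>s. plane_rotation a b s x) has_vector_derivative plane_field a b (plane_rotation a b s x)) (at s)"
proof -
  have [simp]: "a \<bullet> a = 1" "b \<bullet> b = 1" "a \<bullet> b = 0" "b \<bullet> a = 0"
    using assms by (simp_all add: norm_eq_1 inner_commute)
  have eq: "plane_field a b (plane_rotation a b s x) =
     (- sin s) *\<^sub>R ((x \<bullet> a) *\<^sub>R a + (x \<bullet> b) *\<^sub>R b) + cos s *\<^sub>R ((x \<bullet> a) *\<^sub>R b - (x \<bullet> b) *\<^sub>R a)"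
    by (simp add: plane_field_def plane_rotation_def inner_simps algebra_simps)
  show ?thesis unfolding eq unfolding plane_rotation_def
    by (auto intro!: derivative_eq_intros simp: algebra_simps)
qed

text \<open>Along the flow \<open>R\<^sub>s\<close> of the field the integral of \<open>f \<circ> R\<^sub>s\<close> is constant, since rotations preserve
  the area, and the integrand on the left is the derivative of \<open>f (R\<^sub>s x)\<close> at \<open>s = 0\<close>. All integrations
  by parts on the sphere are reduced to this fact. The derivative is taken at points of the
  sphere only, because the test functions used below are singular elsewhere in space.\<close>

lemma integral_S2_plane_field:
  fixes f :: "real^3 \<Rightarrow> real"
  assumes ab: "norm a = 1" "norm b = 1" "a \<bullet> b = 0"
    and f: "\<And>x. norm x = 1 \<Longrightarrow> (f has_derivative f' x) (at x)"
    and cont: "continuous_on (sphere 0 1) (\<lambda>x. f' x (plane_field a b x))"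
  shows "(LINT x|S2. f' x (plane_field a b x)) = 0"
proof -
  let ?R = "plane_rotation a b"
  define g where "g x = f' x (plane_field a b x)" for x
  define e :: "nat \<Rightarrow> real" where "e n = 1 / Suc n" for n
  have e0: "e n > 0" for n by (simp add: e_def)
  have R: "orthogonal_transformation (?R s)" for s
    using orthogonal_plane_rotation[OF ab] .
  have nR: "norm (?R s x) = norm x" for s x
    using orthogonal_transformation_norm[OF R] .
  have contf: "continuous_on (sphere 0 1) f"
    by (intro continuous_at_imp_continuous_on ballI has_derivative_continuous[OF f]) simp
  have deriv: "((\<lambda>s. f (?R s x)) has_vector_derivative g (?R s x)) (at s)" if "norm x = 1" for x s
  proof -
    have "((\<lambda>s. f (?R s x)) has_derivative (\<lambda>h. f' (?R s x) (h *\<^sub>R plane_field a b (?R s x)))) (at s)"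
      using plane_rotation_derivative[OF ab, of x s] f[of "?R s x"] that
      unfolding has_vector_derivative_def
      by (intro has_derivative_compose[where f = "\<lambda>s. ?R s x" and g = f]) (simp_all add: nR)
    moreover have "f' (?R s x) (h *\<^sub>R v) = h *\<^sub>R f' (?R s x) v" for h v
      using f[of "?R s x"] that by (simp add: nR linear_cmul has_derivative_linear)
    ultimately show ?thesis by (simp add: has_vector_derivative_def g_def)
  qed
  have "compact (g ` sphere 0 1)"
    unfolding g_def using cont by (intro compact_continuous_image) auto
  then obtain B where "\<forall>y\<in>g ` sphere 0 1. norm y \<le> B"
    using compact_imp_bounded bounded_iff by metis
  then have B: "\<bar>g x\<bar> \<le> B" if "norm x = 1" for x
    using that by simp
  define D where "D n x = (f (?R (e n) x) - f x) / e n" for n x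
  have "(\<lambda>n. LINT x|S2. D n x) \<longlonglongrightarrow> (LINT x|S2. g x)"
  proof (rule integral_dominated_convergence[where w = "\<lambda>_. B"])
    show "g \<in> borel_measurable S2"
      unfolding g_def by (rule measurable_S2_continuous[OF cont])
    have "continuous_on (sphere 0 1) (\<lambda>x. f (?R s x))" for s
      using R[of s]
      by (intro continuous_on_compose2[OF contf])
        (auto simp: nR intro!: linear_continuous_on linear_conv_bounded_linear[THEN iffD1]
          orthogonal_transformation_linear)
    then show "D n \<in> borel_measurable S2" for n
      unfolding D_def by (intro measurable_S2_continuous continuous_intros contf) (auto simp: e_def)
    show "integrable S2 (\<lambda>_. B)" by simp
    show "AE x in S2. (\<lambda>n. D n x) \<longlonglongrightarrow> g x"
    proof (rule AE_I2)
      fix x :: "real^3" assume "x \<in> space S2"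
      then have x: "norm x = 1" by simp
      have "((\<lambda>h. (f (?R h x) - f x) / h) \<longlongrightarrow> g x) (at 0)"
        using deriv[OF x, of 0]
        by (simp add: has_real_derivative_iff_has_vector_derivative[symmetric] has_field_derivative_iff)
      moreover have "filterlim e (at 0) sequentially"
        unfolding e_def filterlim_at using LIMSEQ_inverse_real_of_nat
        by (simp add: inverse_eq_divide del: of_nat_Suc)
      ultimately show "(\<lambda>n. D n x) \<longlonglongrightarrow> g x"
        unfolding D_def by (rule filterlim_compose)
    qed
    \<comment> \<open>The mean value theorem along the orbit makes each difference quotient a value of \<open>g\<close>.\<close>
    show "AE x in S2. norm (D n x) \<le> B" for n
    proof (rule AE_I2)
      fix x :: "real^3" assume "x \<in> space S2"
      then have x: "norm x = 1" by simp
      obtain s where "0 < s" "s < e n" "f (?R (e n) x) - f (?R 0 x) = (e n - 0) * g (?R s x)"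
        using MVT2[OF e0[of n], of "\<lambda>s. f (?R s x)" "\<lambda>s. g (?R s x)"] deriv[OF x]
        by (auto simp: has_real_derivative_iff_has_vector_derivative)
      then have "D n x = g (?R s x)" using e0[of n] by (simp add: D_def)
      then show "norm (D n x) \<le> B" using B[of "?R s x"] x by (simp add: nR)
    qed
  qed
  moreover have "(LINT x|S2. D n x) = 0" for n
  proof -
    have i: "integrable S2 (\<lambda>x. f (?R (e n) x))"
      using R[of "e n"]
      by (intro integrable_S2_continuous continuous_on_compose2[OF contf])
        (auto simp: nR intro!: linear_continuous_on linear_conv_bounded_linear[THEN iffD1]
          orthogonal_transformation_linear)
    show ?thesis
      unfolding D_def using i integrable_S2_continuous[OF contf] integral_S2_rotation[OF R contf, of "e n"]
      by (simp add: Bochner_Integration.integral_diff)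
  qed
  ultimately have "(LINT x|S2. g x) = 0"
    by (simp add: LIMSEQ_const_iff)
  then show ?thesis by (simp add: g_def)
qed

lemma square_integrable_S2_continuous:
  fixes f :: "real^3 \<Rightarrow> 'b::euclidean_space"
  assumes "continuous_on (sphere 0 1) f"
  shows "square_integrable_S2 f"
  unfolding square_integrable_S2_def
  by (intro conjI measurable_S2_continuous integrable_S2_continuous continuous_intros assms)

text \<open>A tangent field is a combination of rotation fields, \<open>X = (\<Sum>i j. x\<^sub>i X\<^sub>j (x\<^sub>i e\<^sub>j - x\<^sub>j e\<^sub>i))\<close>, because
  \<open>\<bar>x\<bar> = 1\<close> and \<open>X \<bullet> x = 0\<close>. Differentiating the functions \<open>u x\<^sub>i X\<^sub>j\<close> along these fields and summing
  gives \<open>\<nabla>u \<bullet> X + u div X\<close>, and each summand has integral zero. The weak gradient is therefore the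
  tangential part of the gradient in space.\<close>

lemma has_L2_weak_gradient_smooth:
  fixes u :: "real^3 \<Rightarrow> real" and g :: "real^3 \<Rightarrow> real^3"
  assumes u: "\<And>x. norm x = 1 \<Longrightarrow> (u has_derivative (\<lambda>h. g x \<bullet> h)) (at x)"
    and g: "continuous_on (sphere 0 1) g"
  shows "u has_L2_weak_gradient (\<lambda>x. g x - (g x \<bullet> x) *\<^sub>R x)"
  unfolding has_L2_weak_gradient_def
proof (intro conjI allI impI)
  let ?G = "\<lambda>x. g x - (g x \<bullet> x) *\<^sub>R x"
  have contu: "continuous_on (sphere 0 1) u"
    by (intro continuous_at_imp_continuous_on ballI has_derivative_continuous[OF u]) simp
  show "square_integrable_S2 ?G"
    by (intro square_integrable_S2_continuous continuous_intros g)
  show "AE x in S2. ?G x \<bullet> x = 0"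
    by (rule AE_I2) (simp add: inner_diff_left norm_eq_1)
  fix X :: "real^3 \<Rightarrow> real^3" assume X: "smooth_tangent_field X"
  then have "cont_diff (Suc 0) X" and tan: "\<And>x. norm x = 1 \<Longrightarrow> X x \<bullet> x = 0"
    by (auto simp: smooth_tangent_field_def)
  then obtain X' where X': "\<And>x. (X has_derivative X' x) (at x)"
    and "\<And>v. continuous_on UNIV (\<lambda>x. X' x v)"
    by auto
  then have contX': "continuous_on (sphere 0 1) (\<lambda>x. X' x v)" for v
    using continuous_on_subset by blast
  have frX: "frechet_derivative X (at x) = X' x" for x
    using frechet_derivative_at[OF X'] by simp
  have contX: "continuous_on (sphere 0 1) X"
    by (intro continuous_at_imp_continuous_on ballI has_derivative_continuous[OF X'])
  have linX': "linear (X' x)" for x using X' by (rule has_derivative_linear)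
  have X'_field: "X' x (plane_field i j x) = (x \<bullet> i) *\<^sub>R X' x j - (x \<bullet> j) *\<^sub>R X' x i" for x i j
    using linX'[of x] by (simp add: plane_field_def linear_diff linear_cmul)
  define D where "D i j x h = (g x \<bullet> h) * ((x \<bullet> i) * (X x \<bullet> j))
      + u x * ((h \<bullet> i) * (X x \<bullet> j) + (x \<bullet> i) * (X' x h \<bullet> j))" for i j x h
  have D: "((\<lambda>x. u x * ((x \<bullet> i) * (X x \<bullet> j))) has_derivative D i j x) (at x)" if "norm x = 1" for i j x
    unfolding D_def by (auto intro!: derivative_eq_intros u[OF that] X' simp: algebra_simps)
  have contD: "continuous_on (sphere 0 1) (\<lambda>x. D i j x (plane_field i j x))" for i j
    unfolding D_def X'_field unfolding plane_field_def
    by (intro continuous_intros contu contX contX' g)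
  have zero: "(LINT x|S2. D i j x (plane_field i j x)) = 0" if "i \<in> Basis" "j \<in> Basis" for i j
  proof (cases "i = j")
    case True
    then have "D i j x (plane_field i j x) = 0" for x
      using linear_0[OF linX'] by (simp add: D_def plane_field_def)
    then show ?thesis by simp
  next
    case False
    show ?thesis
      by (rule integral_S2_plane_field[OF _ _ _ D contD]) (use False that in \<open>auto simp: inner_Basis\<close>)
  qed
  \<comment> \<open>The diagonal terms vanish; they are included so that double sums factor into single ones.\<close>
  have sum_D: "(\<Sum>i\<in>Basis. \<Sum>j\<in>Basis. D i j x (plane_field i j x)) = ?G x \<bullet> X x + u x * div_S2 X x"
    if x: "norm x = 1" for x
  proof -
    have xx: "(\<Sum>i\<in>Basis. (x \<bullet> i) * (x \<bullet> i)) = 1"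
      using x by (simp add: euclidean_inner[symmetric] norm_eq_1)
    have xX: "(\<Sum>i\<in>Basis. (x \<bullet> i) * (X x \<bullet> i)) = 0"
      using tan[OF x] by (metis euclidean_inner inner_commute)
    have 1: "(\<Sum>i\<in>Basis. \<Sum>j\<in>Basis. (g x \<bullet> plane_field i j x) * ((x \<bullet> i) * (X x \<bullet> j))) = g x \<bullet> X x"
    proof -
      have "(\<Sum>i\<in>Basis. \<Sum>j\<in>Basis. (g x \<bullet> plane_field i j x) * ((x \<bullet> i) * (X x \<bullet> j)))
        = (\<Sum>i\<in>Basis. (x \<bullet> i) * (x \<bullet> i)) * (\<Sum>j\<in>Basis. (g x \<bullet> j) * (X x \<bullet> j))
          - (\<Sum>i\<in>Basis. (x \<bullet> i) * (g x \<bullet> i)) * (\<Sum>j\<in>Basis. (x \<bullet> j) * (X x \<bullet> j))"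
        unfolding sum_product sum_subtractf[symmetric]
        by (intro sum.cong refl) (simp add: plane_field_def inner_simps algebra_simps)
      then show ?thesis using xx xX by (simp add: euclidean_inner[symmetric])
    qed
    have 2: "(\<Sum>i\<in>Basis. \<Sum>j\<in>Basis. (plane_field i j x \<bullet> i) * (X x \<bullet> j)) = 0"
    proof -
      have "(\<Sum>j\<in>Basis. (plane_field i j x \<bullet> i) * (X x \<bullet> j)) = (x \<bullet> i) * (X x \<bullet> i)"
        if i: "i \<in> Basis" for i
      proof -
        have "(\<Sum>j\<in>Basis. (plane_field i j x \<bullet> i) * (X x \<bullet> j))
          = (\<Sum>j\<in>Basis. (if j = i then (x \<bullet> i) * (X x \<bullet> i) else 0)) - (\<Sum>j\<in>Basis. (x \<bullet> j) * (X x \<bullet> j))"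
          unfolding sum_subtractf[symmetric] using i
          by (intro sum.cong refl) (auto simp: plane_field_def inner_simps inner_Basis algebra_simps)
        then show ?thesis using xX i by simp
      qed
      then show ?thesis using xX by simp
    qed
    have 3: "(\<Sum>i\<in>Basis. \<Sum>j\<in>Basis. (x \<bullet> i) * (X' x (plane_field i j x) \<bullet> j)) = div_S2 X x"
    proof -
      have "X' x x = X' x (\<Sum>i\<in>Basis. (x \<bullet> i) *\<^sub>R i)"
        by (simp add: euclidean_representation)
      also have "\<dots> = (\<Sum>i\<in>Basis. (x \<bullet> i) *\<^sub>R X' x i)"
        using linX'[of x] by (simp add: linear_sum linear_cmul)
      finally have X'x: "X' x x = (\<Sum>i\<in>Basis. (x \<bullet> i) *\<^sub>R X' x i)" .
      have "X' x x \<bullet> x = (\<Sum>j\<in>Basis. (X' x x \<bullet> j) * (x \<bullet> j))"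
        by (rule euclidean_inner)
      also have "\<dots> = (\<Sum>j\<in>Basis. \<Sum>i\<in>Basis. (x \<bullet> i) * (x \<bullet> j) * (X' x i \<bullet> j))"
        by (simp add: X'x inner_sum_left sum_distrib_left sum_distrib_right mult_ac)
      also have "\<dots> = (\<Sum>i\<in>Basis. \<Sum>j\<in>Basis. (x \<bullet> i) * (x \<bullet> j) * (X' x i \<bullet> j))"
        by (rule sum.swap)
      finally have "(\<Sum>i\<in>Basis. \<Sum>j\<in>Basis. (x \<bullet> i) * (X' x (plane_field i j x) \<bullet> j))
        = (\<Sum>i\<in>Basis. (x \<bullet> i) * (x \<bullet> i)) * (\<Sum>j\<in>Basis. X' x j \<bullet> j) - X' x x \<bullet> x"
        unfolding sum_product
        by (simp add: sum_subtractf[symmetric] X'_field inner_simps algebra_simps)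
      then show ?thesis using xx by (simp add: div_S2_def frX)
    qed
    have "(\<Sum>i\<in>Basis. \<Sum>j\<in>Basis. D i j x (plane_field i j x)) = g x \<bullet> X x + u x * (0 + div_S2 X x)"
      unfolding 1[symmetric] 2[symmetric] 3[symmetric] D_def
      by (simp add: sum.distrib sum_distrib_left distrib_left)
    then show ?thesis using tan[OF x] by (simp add: inner_simps inner_commute)
  qed
  have contdiv: "continuous_on (sphere 0 1) (\<lambda>x. div_S2 X x)"
  proof -
    have "X' x x = (\<Sum>i\<in>Basis. (x \<bullet> i) *\<^sub>R X' x i)" for x
      using linX'[of x] euclidean_representation[of x] by (metis (no_types, lifting) linear_cmul linear_sum sum.cong)
    then show ?thesis
      unfolding div_S2_def frX by (auto intro!: continuous_intros contX')
  qed
  have "0 = (\<Sum>i\<in>Basis. \<Sum>j\<in>Basis. LINT x|S2. D i j x (plane_field i j x))"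
    using zero by simp
  also have "\<dots> = (LINT x|S2. (\<Sum>i\<in>Basis. \<Sum>j\<in>Basis. D i j x (plane_field i j x)))"
    by (simp add: Bochner_Integration.integral_sum integrable_S2_continuous contD)
  also have "\<dots> = (LINT x|S2. ?G x \<bullet> X x + u x * div_S2 X x)"
    by (rule integral_S2_cong) (rule sum_D)
  also have "\<dots> = (LINT x|S2. ?G x \<bullet> X x) + (LINT x|S2. u x * div_S2 X x)"
    by (intro Bochner_Integration.integral_add integrable_S2_continuous continuous_intros
        g contX contu contdiv)
  finally show "(LINT x|S2. u x * div_S2 X x) = - (LINT x|S2. ?G x \<bullet> X x)"
    by linarith
qed

section \<open>Integrals of zonal functions\<close>

text \<open>For \<open>t = x \<bullet> e\<close> and \<open>b\<close> orthogonal to \<open>e\<close>, the derivative of \<open>t\<^sup>n (x \<bullet> b)\<close> along the rotation field of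
  \<open>e, b\<close> is \<open>t\<^sup>n\<^sup>+\<^sup>1 - n t\<^sup>n\<^sup>-\<^sup>1 (x \<bullet> b)\<^sup>2\<close>. Summing over the two directions \<open>b\<close> and using \<open>\<bar>x\<bar> = 1\<close> yields the
  recursion \<open>(k + 3) M\<^sub>k\<^sub>+\<^sub>2 = (k + 1) M\<^sub>k\<close> for the moments of the height function.\<close>

lemma integral_S2_power:
  fixes e :: "real^3"
  assumes e: "e \<in> Basis"
  shows "(LINT x|S2. (x \<bullet> e) ^ k) = 2 * pi * (1 - (-1) ^ Suc k) / Suc k"
proof -
  define M where "M k = (LINT x|S2. (x \<bullet> e) ^ k)" for k
  have int: "integrable S2 (\<lambda>x. (x \<bullet> e) ^ k * (x \<bullet> b) ^ l)" for k l b
    by (intro integrable_S2_continuous continuous_intros)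
  have int1: "integrable S2 (\<lambda>x. (x \<bullet> e) ^ k)" for k
    by (intro integrable_S2_continuous continuous_intros)
  have field: "M (Suc n) = n * (LINT x|S2. (x \<bullet> e) ^ (n - 1) * (x \<bullet> b)\<^sup>2)"
    if b: "b \<in> Basis - {e}" for b n
  proof -
    let ?D = "\<lambda>x h. n * (x \<bullet> e) ^ (n - 1) * (h \<bullet> e) * (x \<bullet> b) + (x \<bullet> e) ^ n * (h \<bullet> b)"
    have field: "?D x (plane_field e b x) = (x \<bullet> e) ^ Suc n - n * ((x \<bullet> e) ^ (n - 1) * (x \<bullet> b)\<^sup>2)" for x
      using e b by (auto simp: plane_field_def inner_simps inner_Basis power2_eq_square)
    have "(LINT x|S2. ?D x (plane_field e b x)) = 0"
    proof (rule integral_S2_plane_field)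
      show "((\<lambda>x. (x \<bullet> e) ^ n * (x \<bullet> b)) has_derivative ?D x) (at x)" for x
        by (auto intro!: derivative_eq_intros simp: algebra_simps)
      show "continuous_on (sphere 0 1) (\<lambda>x. ?D x (plane_field e b x))"
        unfolding field by (intro continuous_intros)
    qed (use e b in \<open>auto simp: inner_Basis\<close>)
    then show ?thesis
      unfolding field M_def using int1[of "Suc n"] int[of "n - 1" b 2]
      by (simp del: power_Suc)
  qed
  have M0: "M 0 = 4 * pi" by (simp add: M_def measure_S2_total)
  have "card (Basis - {e}) = 2" using e by (simp add: card_Diff_singleton)
  then have "Basis - {e} \<noteq> {}" by (metis card.empty zero_neq_numeral)
  then obtain b where "b \<in> Basis - {e}" by blast
  then have M1: "M (Suc 0) = 0" using field[of b 0] by simp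
  have rec: "M (Suc (Suc k)) = (k + 1) / (k + 3) * M k" for k
  proof -
    have "2 * M (Suc (Suc k)) = (\<Sum>b\<in>Basis - {e}. M (Suc (Suc k)))"
      using \<open>card (Basis - {e}) = 2\<close> by simp
    also have "\<dots> = (\<Sum>b\<in>Basis - {e}. Suc k * (LINT x|S2. (x \<bullet> e) ^ k * (x \<bullet> b)\<^sup>2))"
      by (intro sum.cong refl) (use field[of _ "Suc k"] in auto)
    also have "\<dots> = Suc k * (LINT x|S2. (\<Sum>b\<in>Basis - {e}. (x \<bullet> e) ^ k * (x \<bullet> b)\<^sup>2))"
      by (subst Bochner_Integration.integral_sum) (simp_all only: sum_distrib_left int)
    also have "(LINT x|S2. (\<Sum>b\<in>Basis - {e}. (x \<bullet> e) ^ k * (x \<bullet> b)\<^sup>2))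
        = (LINT x|S2. (x \<bullet> e) ^ k - (x \<bullet> e) ^ Suc (Suc k))"
    proof (rule integral_S2_cong)
      fix x :: "real^3" assume "norm x = 1"
      then have "(\<Sum>b\<in>Basis. (x \<bullet> b)\<^sup>2) = 1"
        by (simp add: norm_eq_1 euclidean_inner[of x x] power2_eq_square)
      then have "(\<Sum>b\<in>Basis - {e}. (x \<bullet> b)\<^sup>2) = 1 - (x \<bullet> e)\<^sup>2"
        using e by (simp add: sum_diff1)
      then have "(\<Sum>b\<in>Basis - {e}. (x \<bullet> e) ^ k * (x \<bullet> b)\<^sup>2) = (x \<bullet> e) ^ k * (1 - (x \<bullet> e)\<^sup>2)"
        by (simp add: sum_distrib_left[symmetric])
      then show "(\<Sum>b\<in>Basis - {e}. (x \<bullet> e) ^ k * (x \<bullet> b)\<^sup>2) = (x \<bullet> e) ^ k - (x \<bullet> e) ^ Suc (Suc k)"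
        by (simp add: algebra_simps power2_eq_square)
    qed
    also have "\<dots> = M k - M (Suc (Suc k))"
      unfolding M_def by (rule Bochner_Integration.integral_diff[OF int1 int1])
    finally show ?thesis by (simp add: field_simps)
  qed
  have "M k = 2 * pi * (1 - (-1) ^ Suc k) / Suc k"
  proof (induction k rule: induct_nat_012)
    case (ge2 k)
    then show ?case by (simp add: rec field_simps)
  qed (simp_all add: M0 M1)
  then show ?thesis by (simp add: M_def)
qed

lemma has_integral_power:
  "((\<lambda>t::real. t ^ k) has_integral (1 - (-1) ^ Suc k) / Suc k) {-1..1}"
proof -
  have "((\<lambda>t::real. t ^ k) has_integral (1 ^ Suc k / Suc k - (-1) ^ Suc k / Suc k)) {-1..1}"
  proof (rule fundamental_theorem_of_calculus)
    show "((\<lambda>t. t ^ Suc k / Suc k) has_vector_derivative t ^ k) (at t within {-1..1})" for t :: real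
      unfolding has_real_derivative_iff_has_vector_derivative[symmetric]
      by (rule derivative_eq_intros refl | simp del: of_nat_Suc power_Suc)+
  qed simp
  then show ?thesis by (simp add: diff_divide_distrib add_divide_distrib)
qed

lemma zonal_range: "norm x = 1 \<Longrightarrow> norm e = 1 \<Longrightarrow> x \<bullet> (e :: 'a::real_inner) \<in> {-1..1}"
  using Cauchy_Schwarz_ineq2[of x e] by auto

lemma continuous_on_zonal:
  fixes e :: "real^3" and h :: "real \<Rightarrow> real"
  assumes "norm e = 1" "continuous_on {-1..1} h"
  shows "continuous_on (sphere 0 1) (\<lambda>x. h (x \<bullet> e))"
proof (rule continuous_on_compose2[OF assms(2)])
  show "(\<lambda>x. x \<bullet> e) ` sphere 0 1 \<subseteq> {-1..1}"
    using zonal_range[OF _ assms(1)] by force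
qed (intro continuous_intros)

lemma integral_S2_zonal_Basis:
  fixes e :: "real^3" and h :: "real \<Rightarrow> real"
  assumes e: "e \<in> Basis" and h: "continuous_on {-1..1} h"
  shows "(LINT x|S2. h (x \<bullet> e)) = 2 * pi * integral {-1..1} h"
proof -
  have ne: "norm e = 1" using e by simp
  have poly: "(LINT x|S2. p (x \<bullet> e)) = 2 * pi * integral {-1..1} p"
    if p: "real_polynomial_function p" for p
  proof -
    obtain a n where sum: "p = (\<lambda>x. \<Sum>i\<le>n. a i * x ^ i)"
      using p unfolding real_polynomial_function_iff_sum by blast
    have "(p has_integral (\<Sum>i\<le>n. a i * ((1 - (-1) ^ Suc i) / Suc i))) {-1..1}"
      unfolding sum by (intro has_integral_sum has_integral_mult_right has_integral_power) simp
    then have "integral {-1..1} p = (\<Sum>i\<le>n. a i * ((1 - (-1) ^ Suc i) / Suc i))"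
      by (rule integral_unique)
    moreover have "(LINT x|S2. p (x \<bullet> e)) = (\<Sum>i\<le>n. a i * (LINT x|S2. (x \<bullet> e) ^ i))"
      unfolding sum
      by (subst Bochner_Integration.integral_sum)
        (auto intro!: integrable_S2_continuous continuous_intros)
    ultimately show ?thesis
      unfolding integral_S2_power[OF e] by (simp add: sum_distrib_left algebra_simps)
  qed
  have "\<bar>(LINT x|S2. h (x \<bullet> e)) - 2 * pi * integral {-1..1} h\<bar> \<le> 8 * pi * d" if d: "d > 0" for d
  proof -
    obtain p where p: "real_polynomial_function p" and le: "\<And>t. t \<in> {-1..1} \<Longrightarrow> \<bar>h t - p t\<bar> < d"
      using Stone_Weierstrass_real_polynomial_function[OF _ h d] by auto
    have cp: "continuous_on {-1..1} p"
      using p by (intro continuous_on_polymonial_function) (simp add: real_polynomial_function_eq[symmetric])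
    have ch: "continuous_on (sphere 0 1) (\<lambda>x. h (x \<bullet> e))" and cpe: "continuous_on (sphere 0 1) (\<lambda>x. p (x \<bullet> e))"
      using continuous_on_zonal[OF ne] h cp by auto
    have "\<bar>(LINT x|S2. h (x \<bullet> e)) - (LINT x|S2. p (x \<bullet> e))\<bar> = \<bar>LINT x|S2. h (x \<bullet> e) - p (x \<bullet> e)\<bar>"
      by (simp add: Bochner_Integration.integral_diff integrable_S2_continuous ch cpe)
    also have "\<dots> \<le> (LINT x|S2. \<bar>h (x \<bullet> e) - p (x \<bullet> e)\<bar>)"
      by (rule integral_abs_bound)
    also have "\<dots> \<le> (LINT x|(S2 :: (real^3) measure). d)"
      by (rule integral_S2_mono) (use le zonal_range[OF _ ne] in \<open>auto intro!: continuous_intros ch cpe less_imp_le\<close>)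
    finally have 1: "\<bar>(LINT x|S2. h (x \<bullet> e)) - (LINT x|S2. p (x \<bullet> e))\<bar> \<le> 4 * pi * d" by simp
    have "\<bar>integral {-1..1} p - integral {-1..1} h\<bar> = norm (integral {-1..1} (\<lambda>t. p t - h t))"
      by (simp add: integral_diff integrable_continuous_real cp h)
    also have "\<dots> \<le> integral {-1..1} (\<lambda>_::real. d)"
      by (rule integral_norm_bound_integral)
        (use le in \<open>auto intro!: integrable_continuous_real continuous_intros cp h less_imp_le simp: abs_minus_commute\<close>)
    finally have "\<bar>integral {-1..1} p - integral {-1..1} h\<bar> \<le> 2 * d" by simp
    then have "2 * pi * \<bar>integral {-1..1} p - integral {-1..1} h\<bar> \<le> 2 * pi * (2 * d)"
      by (intro mult_left_mono) auto
    then have "\<bar>2 * pi * integral {-1..1} p - 2 * pi * integral {-1..1} h\<bar> \<le> 4 * pi * d"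
      by (simp add: abs_mult right_diff_distrib[symmetric])
    then show ?thesis using 1 poly[OF p] by linarith
  qed
  note bound = this
  have "\<bar>(LINT x|S2. h (x \<bullet> e)) - 2 * pi * integral {-1..1} h\<bar> \<le> 0 + d" if "d > 0" for d
    using bound[of "d / (8 * pi)"] that by simp
  then have "\<bar>(LINT x|S2. h (x \<bullet> e)) - 2 * pi * integral {-1..1} h\<bar> \<le> 0"
    by (rule field_le_epsilon)
  then show ?thesis by simp
qed

text \<open>The hat-box theorem of Archimedes: the height over the equatorial plane orthogonal to \<open>e\<close> is
  uniformly distributed on \<open>[-1, 1]\<close>. The moments determine this by the Weierstrass theorem.\<close>

lemma integral_S2_zonal:
  fixes e :: "real^3" and h :: "real \<Rightarrow> real"
  assumes e: "norm e = 1" and h: "continuous_on {-1..1} h"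
  shows "(LINT x|S2. h (x \<bullet> e)) = 2 * pi * integral {-1..1} h"
proof -
  obtain b :: "real^3" where b: "b \<in> Basis" using nonempty_Basis by blast
  then obtain f where f: "orthogonal_transformation f" "f b = e"
    using orthogonal_transformation_exists_1[of b e] e by auto
  have "(LINT x|S2. h (x \<bullet> e)) = (LINT x|S2. h (f x \<bullet> e))"
    by (rule integral_S2_rotation[symmetric, OF f(1) continuous_on_zonal[OF e h]])
  also have "\<dots> = (LINT x|S2. h (x \<bullet> b))"
    using f by (simp add: orthogonal_transformation_def flip: f(2))
  finally show ?thesis using integral_S2_zonal_Basis[OF b h] by simp
qed

section \<open>Polynomials\<close>

lemma poly_spaceI:
  assumes "\<And>x. p x = (\<Sum>\<alpha> | (\<Sum>i\<in>UNIV. \<alpha> i) \<le> k. c \<alpha> * (\<Prod>i\<in>UNIV. x $ i ^ \<alpha> i))"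
  shows "p \<in> poly_space k"
  using assms unfolding poly_space_def by blast

lemma poly_space_add:
  assumes "p \<in> poly_space k" "q \<in> poly_space k"
  shows "(\<lambda>x. p x + q x) \<in> poly_space k"
proof -
  obtain c d where "\<And>x. p x = (\<Sum>\<alpha> | (\<Sum>i\<in>UNIV. \<alpha> i) \<le> k. c \<alpha> * (\<Prod>i\<in>UNIV. x $ i ^ \<alpha> i))"
    "\<And>x. q x = (\<Sum>\<alpha> | (\<Sum>i\<in>UNIV. \<alpha> i) \<le> k. d \<alpha> * (\<Prod>i\<in>UNIV. x $ i ^ \<alpha> i))"
    using assms unfolding poly_space_def by blast
  then show ?thesis
    by (intro poly_spaceI[where c = "\<lambda>\<alpha>. c \<alpha> + d \<alpha>"]) (simp add: distrib_right sum.distrib)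
qed

lemma poly_space_cmult:
  assumes "p \<in> poly_space k"
  shows "(\<lambda>x. r * p x) \<in> poly_space k"
proof -
  obtain c where "\<And>x. p x = (\<Sum>\<alpha> | (\<Sum>i\<in>UNIV. \<alpha> i) \<le> k. c \<alpha> * (\<Prod>i\<in>UNIV. x $ i ^ \<alpha> i))"
    using assms unfolding poly_space_def by blast
  then show ?thesis
    by (intro poly_spaceI[where c = "\<lambda>\<alpha>. r * c \<alpha>"]) (simp add: sum_distrib_left mult.assoc)
qed

lemma poly_space_mono:
  assumes "p \<in> poly_space k" "k \<le> l"
  shows "p \<in> poly_space l"
proof -
  obtain c where c: "\<And>x. p x = (\<Sum>\<alpha> | (\<Sum>i\<in>UNIV. \<alpha> i) \<le> k. c \<alpha> * (\<Prod>i\<in>UNIV. x $ i ^ \<alpha> i))"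
    using assms unfolding poly_space_def by blast
  show ?thesis
    by (rule poly_spaceI[where c = "\<lambda>\<alpha>. if (\<Sum>i\<in>UNIV. \<alpha> i) \<le> k then c \<alpha> else 0"], unfold c,
        rule sum.mono_neutral_cong_left)
      (use assms in \<open>auto simp: finite_multi_indices\<close>)
qed

lemma poly_space_const: "(\<lambda>x. r) \<in> poly_space k"
proof -
  have "(\<lambda>x::real^3. r) \<in> poly_space 0"
  proof (rule poly_spaceI[where c = "\<lambda>_. r"])
    have "{\<alpha> :: 3 \<Rightarrow> nat. (\<Sum>i\<in>UNIV. \<alpha> i) \<le> 0} = {\<lambda>_. 0}" by (auto simp: fun_eq_iff)
    then show "r = (\<Sum>\<alpha> | (\<Sum>i\<in>UNIV. \<alpha> i) \<le> 0. r * (\<Prod>i\<in>UNIV. x $ i ^ \<alpha> i))" for x :: "real^3"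
      by simp
  qed
  then show ?thesis by (rule poly_space_mono) simp
qed

lemma poly_space_sum:
  assumes "\<And>i. i \<in> I \<Longrightarrow> f i \<in> poly_space k"
  shows "(\<lambda>x. \<Sum>i\<in>I. f i x) \<in> poly_space k"
  using assms
  by (induction I rule: infinite_finite_induct) (auto intro: poly_space_const poly_space_add)

lemma poly_space_mult_coordinate:
  assumes "p \<in> poly_space k"
  shows "(\<lambda>x. x $ j * p x) \<in> poly_space (Suc k)"
proof -
  obtain c where c: "\<And>x. p x = (\<Sum>\<alpha> | (\<Sum>i\<in>UNIV. \<alpha> i) \<le> k. c \<alpha> * (\<Prod>i\<in>UNIV. x $ i ^ \<alpha> i))"
    using assms unfolding poly_space_def by blast
  let ?up = "\<lambda>\<alpha>::3\<Rightarrow>nat. \<alpha>(j := Suc (\<alpha> j))" and ?dn = "\<lambda>\<alpha>::3\<Rightarrow>nat. \<alpha>(j := \<alpha> j - 1)"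
  have up: "?up \<alpha> i = \<alpha> i + (if i = j then 1 else 0)" for \<alpha> i
    by simp
  have s: "(\<Sum>i\<in>UNIV. ?up \<alpha> i) = Suc (\<Sum>i\<in>UNIV. \<alpha> i)" for \<alpha>
    unfolding up sum.distrib by simp
  have m: "(\<Prod>i\<in>UNIV. x $ i ^ ?up \<alpha> i) = x $ j * (\<Prod>i\<in>UNIV. x $ i ^ \<alpha> i)" for \<alpha> and x :: "real^3"
    unfolding up power_add prod.distrib by (simp add: if_distrib[of "(^) _"] cong: if_cong)
  show ?thesis
  proof (rule poly_spaceI[where c = "\<lambda>\<alpha>. if \<alpha> j = 0 then 0 else c (?dn \<alpha>)"])
    fix x :: "real^3"
    have "x $ j * p x = (\<Sum>\<alpha> | (\<Sum>i\<in>UNIV. \<alpha> i) \<le> k. c \<alpha> * (\<Prod>i\<in>UNIV. x $ i ^ ?up \<alpha> i))"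
      unfolding c m by (simp add: sum_distrib_left algebra_simps)
    also have "\<dots> = (\<Sum>\<beta>\<in>{\<beta>. (\<Sum>i\<in>UNIV. \<beta> i) \<le> Suc k \<and> \<beta> j \<noteq> 0}. c (?dn \<beta>) * (\<Prod>i\<in>UNIV. x $ i ^ \<beta> i))"
    proof (rule sum.reindex_bij_witness[where j = ?up and i = ?dn])
      fix \<beta> :: "3 \<Rightarrow> nat" assume b: "\<beta> \<in> {\<beta>. (\<Sum>i\<in>UNIV. \<beta> i) \<le> Suc k \<and> \<beta> j \<noteq> 0}"
      then show id: "?up (?dn \<beta>) = \<beta>" by auto
      show "?dn \<beta> \<in> {\<alpha>. (\<Sum>i\<in>UNIV. \<alpha> i) \<le> k}" using b s[of "?dn \<beta>"] unfolding id by simp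
    next
      fix \<alpha> :: "3 \<Rightarrow> nat" assume "\<alpha> \<in> {\<alpha>. (\<Sum>i\<in>UNIV. \<alpha> i) \<le> k}"
      then show "?up \<alpha> \<in> {\<beta>. (\<Sum>i\<in>UNIV. \<beta> i) \<le> Suc k \<and> \<beta> j \<noteq> 0}" using s[of \<alpha>] by auto
    qed auto
    also have "\<dots> = (\<Sum>\<alpha> | (\<Sum>i\<in>UNIV. \<alpha> i) \<le> Suc k. (if \<alpha> j = 0 then 0 else c (?dn \<alpha>)) * (\<Prod>i\<in>UNIV. x $ i ^ \<alpha> i))"
      by (rule sum.mono_neutral_cong_left) (auto simp: finite_multi_indices)
    finally show "x $ j * p x = \<dots>" .
  qed
qed

lemma poly_space_mult_inner:
  assumes "p \<in> poly_space k"
  shows "(\<lambda>x. (x \<bullet> z) * p x) \<in> poly_space (Suc k)"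
proof -
  have eq: "(\<lambda>x. (x \<bullet> z) * p x) = (\<lambda>x. \<Sum>j\<in>UNIV. z $ j * (x $ j * p x))"
    by (simp add: inner_vec_def sum_distrib_left sum_distrib_right algebra_simps)
  show ?thesis unfolding eq
    by (rule poly_space_sum, rule poly_space_cmult, rule poly_space_mult_coordinate, rule assms)
qed

lemma poly_space_inner_power: "(\<lambda>x. (x \<bullet> z) ^ n) \<in> poly_space n"
proof (induction n)
  case (Suc n)
  show ?case using poly_space_mult_inner[OF Suc, of z] by simp
qed (simp add: poly_space_const)

lemma continuous_on_poly_space:
  assumes "p \<in> poly_space k"
  shows "continuous_on S p"
proof -
  obtain c where c: "\<And>x. p x = (\<Sum>\<alpha> | (\<Sum>i\<in>UNIV. \<alpha> i) \<le> k. c \<alpha> * (\<Prod>i\<in>UNIV. x $ i ^ \<alpha> i))"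
    using assms unfolding poly_space_def by blast
  have "continuous_on S (\<lambda>x. p x)" unfolding c
    by (rule continuous_on_sum, rule continuous_on_mult, rule continuous_on_const,
        rule continuous_on_prod) (intro continuous_intros)
  then show ?thesis by simp
qed

text \<open>Polarisation: powers of linear forms span all polynomials. The value of \<open>\<Lambda>\<close> at
  \<open>(s x\<^sub>1 + t x\<^sub>2 + x\<^sub>3)\<^sup>k\<close> is a polynomial in \<open>s\<close> and \<open>t\<close> whose coefficients are positive multiples of
  the values of \<open>\<Lambda>\<close> at the monomials of degree \<open>k\<close>; if it vanishes identically, so do these.\<close>

lemma linear_functional_vanishes_on_poly_space:
  fixes \<Lambda> :: "(real^3 \<Rightarrow> real) \<Rightarrow> real"
  assumes add: "\<And>p q. continuous_on UNIV p \<Longrightarrow> continuous_on UNIV q \<Longrightarrow> \<Lambda> (\<lambda>x. p x + q x) = \<Lambda> p + \<Lambda> q"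
    and cmult: "\<And>p r. continuous_on UNIV p \<Longrightarrow> \<Lambda> (\<lambda>x. r * p x) = r * \<Lambda> p"
    and powers: "\<And>z k. k \<le> m \<Longrightarrow> \<Lambda> (\<lambda>x. (x \<bullet> z) ^ k) = 0"
    and p: "p \<in> poly_space m"
  shows "\<Lambda> p = 0"
proof -
  have zero: "\<Lambda> (\<lambda>_. 0) = 0" using cmult[of "\<lambda>_. 0" 0] by simp
  have sum: "\<Lambda> (\<lambda>x. \<Sum>i\<in>I. c i * f i x) = (\<Sum>i\<in>I. c i * \<Lambda> (f i))"
    if "finite I" "\<And>i. i \<in> I \<Longrightarrow> continuous_on UNIV (f i)"
    for I :: "'i set" and c f
    using that by (induction I) (auto simp: zero add cmult continuous_intros)
  have mono: "\<Lambda> (\<lambda>x. x $ 1 ^ i * (x $ 2 ^ j * x $ 3 ^ (k - i - j))) = 0"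
    if ijk: "k \<le> m" "i \<le> k" "j \<le> k - i" for i j k
  proof -
    let ?L = "\<lambda>i j. \<Lambda> (\<lambda>x. x $ 1 ^ i * (x $ 2 ^ j * x $ 3 ^ (k - i - j)))"
    have expand: "(\<Sum>i\<le>k. (\<Sum>j\<le>k - i. (real (k choose i) * real (k - i choose j) * ?L i j) * t ^ j) * s ^ i) = 0"
      for s t :: real
    proof -
      have "(\<lambda>x::real^3. (x \<bullet> vector [s, t, 1]) ^ k)
         = (\<lambda>x. \<Sum>i\<le>k. 1 * (\<Sum>j\<le>k - i. (real (k choose i) * real (k - i choose j) * t ^ j * s ^ i) *
               (x $ 1 ^ i * (x $ 2 ^ j * x $ 3 ^ (k - i - j)))))"
      proof
        fix x :: "real^3"
        have "(x \<bullet> vector [s, t, 1]) ^ k = (s * x $ 1 + (t * x $ 2 + x $ 3)) ^ k"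
          by (simp add: inner_vec_def sum_3 algebra_simps)
        also have "\<dots> = (\<Sum>i\<le>k. of_nat (k choose i) * (s * x $ 1) ^ i * (t * x $ 2 + x $ 3) ^ (k - i))"
          by (rule binomial_ring)
        also have "\<dots> = (\<Sum>i\<le>k. of_nat (k choose i) * (s * x $ 1) ^ i *
            (\<Sum>j\<le>k - i. of_nat (k - i choose j) * (t * x $ 2) ^ j * x $ 3 ^ (k - i - j)))"
          by (simp add: binomial_ring)
        also have "\<dots> = (\<Sum>i\<le>k. 1 * (\<Sum>j\<le>k - i. (real (k choose i) * real (k - i choose j) * t ^ j * s ^ i) *
               (x $ 1 ^ i * (x $ 2 ^ j * x $ 3 ^ (k - i - j)))))"
          by (intro sum.cong refl) (simp add: sum_distrib_left power_mult_distrib algebra_simps)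
        finally show "(x \<bullet> vector [s, t, 1]) ^ k = \<dots>" .
      qed
      then have "0 = \<Lambda> (\<lambda>x. \<Sum>i\<le>k. 1 * (\<Sum>j\<le>k - i. (real (k choose i) * real (k - i choose j) * t ^ j * s ^ i) *
               (x $ 1 ^ i * (x $ 2 ^ j * x $ 3 ^ (k - i - j)))))"
        using powers[OF ijk(1), of "vector [s, t, 1]"] by simp
      also have "\<dots> = (\<Sum>i\<le>k. 1 * \<Lambda> (\<lambda>x. \<Sum>j\<le>k - i. (real (k choose i) * real (k - i choose j) * t ^ j * s ^ i) *
               (x $ 1 ^ i * (x $ 2 ^ j * x $ 3 ^ (k - i - j)))))"
        by (rule sum) (auto intro!: continuous_intros)
      also have "\<dots> = (\<Sum>i\<le>k. 1 * (\<Sum>j\<le>k - i. (real (k choose i) * real (k - i choose j) * t ^ j * s ^ i) * ?L i j))"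
        by (intro sum.cong refl arg_cong2[of _ _ _ _ "(*)"] sum) (auto intro!: continuous_intros)
      finally show ?thesis by (simp add: sum_distrib_right sum_distrib_left algebra_simps)
    qed
    have "(\<Sum>j\<le>k - i. (real (k choose i) * real (k - i choose j) * ?L i j) * t ^ j) = 0" for t
      using polyfun_eq_0[of "\<lambda>i. \<Sum>j\<le>k - i. (real (k choose i) * real (k - i choose j) * ?L i j) * t ^ j" k]
        expand[of t] ijk(2) by blast
    then have "real (k choose i) * real (k - i choose j) * ?L i j = 0"
      using polyfun_eq_0[of "\<lambda>j. real (k choose i) * real (k - i choose j) * ?L i j" "k - i"] ijk(3) by blast
    then show ?thesis using ijk by simp
  qed
  obtain c where c: "p = (\<lambda>x. \<Sum>\<alpha> | (\<Sum>i\<in>UNIV. \<alpha> i) \<le> m. c \<alpha> * (\<Prod>i\<in>UNIV. x $ i ^ \<alpha> i))"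
    using p unfolding poly_space_def by auto
  have "\<Lambda> p = (\<Sum>\<alpha> | (\<Sum>i\<in>UNIV. \<alpha> i) \<le> m. c \<alpha> * \<Lambda> (\<lambda>x. \<Prod>i\<in>UNIV. x $ i ^ \<alpha> i))"
    unfolding c by (rule sum) (auto intro!: continuous_intros simp: finite_multi_indices)
  also have "\<dots> = 0"
  proof (intro sum.neutral ballI)
    fix \<alpha> :: "3 \<Rightarrow> nat" assume "\<alpha> \<in> {\<alpha>. (\<Sum>i\<in>UNIV. \<alpha> i) \<le> m}"
    then have "\<Lambda> (\<lambda>x. x $ 1 ^ \<alpha> 1 * (x $ 2 ^ \<alpha> 2 * x $ 3 ^ (\<alpha> 1 + \<alpha> 2 + \<alpha> 3 - \<alpha> 1 - \<alpha> 2))) = 0"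
      by (intro mono) (auto simp: sum_3)
    moreover have "(\<Prod>i\<in>UNIV. x $ i ^ \<alpha> i) = x $ 1 ^ \<alpha> 1 * (x $ 2 ^ \<alpha> 2 * x $ 3 ^ \<alpha> 3)" for x :: "real^3"
      unfolding UNIV_3 by simp
    ultimately show "c \<alpha> * \<Lambda> (\<lambda>x. \<Prod>i\<in>UNIV. x $ i ^ \<alpha> i) = 0"
      by simp
  qed
  finally show ?thesis .
qed

section \<open>Zonal kernels preserve cubature rules\<close>

lemma reflection_exists:
  fixes a b :: "'a::euclidean_space"
  assumes "norm a = norm b"
  obtains f where "orthogonal_transformation f" "f a = b" "\<And>x. x \<bullet> a = x \<bullet> b \<Longrightarrow> f x = x"
proof (cases "a = b")
  case True
  then show ?thesis using that[of "\<lambda>x. x"] by simp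
next
  case False
  define v where "v = a - b"
  define f where "f x = x - (2 * (x \<bullet> v) / (v \<bullet> v)) *\<^sub>R v" for x
  have v: "v \<bullet> v \<noteq> 0" using False by (simp add: v_def)
  show ?thesis
  proof
    have "norm (f x) = norm x" for x
    proof -
      have "f x \<bullet> f x = x \<bullet> x"
        using v by (simp add: f_def inner_simps inner_commute[of v x] field_simps)
      then show ?thesis by (simp add: norm_eq_sqrt_inner)
    qed
    moreover have "linear f"
      by (rule linearI) (simp_all add: f_def inner_simps add_divide_distrib algebra_simps)
    ultimately show "orthogonal_transformation f"
      by (simp add: orthogonal_transformation)
    have "2 * (a \<bullet> v) = v \<bullet> v"
      using assms by (simp add: v_def inner_simps inner_commute norm_eq)
    then show "f a = b" using v by (simp add: f_def v_def)
    show "f x = x" if "x \<bullet> a = x \<bullet> b" for x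
      using that by (simp add: f_def v_def inner_diff_right)
  qed
qed

lemma continuous_on_zonal_moment:
  fixes x w :: "real^3"
  assumes "norm x = 1" "continuous_on {-1..1} h"
  shows "continuous_on (sphere 0 1) (\<lambda>y. h (y \<bullet> x) * (y \<bullet> w) ^ l)"
  by (intro continuous_intros continuous_on_zonal assms)

text \<open>Any orthonormal pair is carried to any other by a rotation, so that the integral depends on \<open>w\<close> only
  through its length; the reflection \<open>w \<mapsto> - w\<close> makes it vanish for odd \<open>l\<close>.\<close>

lemma zonal_moment:
  fixes h :: "real \<Rightarrow> real"
  assumes h: "continuous_on {-1..1} h"
  obtains c where "\<And>x w :: real^3. norm x = 1 \<Longrightarrow> x \<bullet> w = 0 \<Longrightarrow>
    (LINT y|S2. h (y \<bullet> x) * (y \<bullet> w) ^ l) = (if even l then c * (w \<bullet> w) ^ (l div 2) else 0)"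
proof -
  define e1 e2 :: "real^3" where "e1 = axis 1 1" and "e2 = axis 2 1"
  have e: "norm e1 = 1" "norm e2 = 1" "e1 \<bullet> e2 = 0"
    by (simp_all add: e1_def e2_def inner_axis_axis)
  define c where "c = (LINT y|S2. h (y \<bullet> e1) * (y \<bullet> e2) ^ l)"
  have odd: "c = 0" if "odd l"
  proof -
    obtain f where f: "orthogonal_transformation f" "f e2 = - e2" "f e1 = e1"
      using reflection_exists[of e2 "- e2"] e by (metis inner_minus_right minus_zero norm_minus_cancel)
    have fi: "f y \<bullet> e1 = y \<bullet> e1" "f y \<bullet> e2 = - (y \<bullet> e2)" for y
    proof -
      have "f y \<bullet> f e1 = y \<bullet> e1" "f y \<bullet> f e2 = y \<bullet> e2"
        using f(1) by (simp_all add: orthogonal_transformation_def)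
      then show "f y \<bullet> e1 = y \<bullet> e1" "f y \<bullet> e2 = - (y \<bullet> e2)"
        using f(2,3) by simp_all
    qed
    have "c = (LINT y|S2. h (f y \<bullet> e1) * (f y \<bullet> e2) ^ l)"
      unfolding c_def by (rule integral_S2_rotation[symmetric, OF f(1) continuous_on_zonal_moment[OF e(1) h]])
    also have "\<dots> = - c" using that unfolding fi c_def by (simp add: power_minus_odd)
    finally show ?thesis by simp
  qed
  show ?thesis
  proof (rule that[of c])
    fix x w :: "real^3" assume x: "norm x = 1" and xw: "x \<bullet> w = 0"
    have pw: "norm w ^ l = (w \<bullet> w) ^ (l div 2)" if "even l"
      using that by (metis dvd_mult_div_cancel power2_norm_eq_inner power_mult)
    have "(LINT y|S2. h (y \<bullet> x) * (y \<bullet> w) ^ l) = norm w ^ l * c"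
    proof (cases "w = 0")
      case True
      have "(LINT y|S2. h (y \<bullet> x)) = (LINT y|S2. h (y \<bullet> e1))"
        by (simp add: integral_S2_zonal x e h)
      then show ?thesis using True by (cases "l = 0") (simp_all add: c_def)
    next
      case False
      define v where "v = w /\<^sub>R norm w"
      have v: "norm v = 1" "x \<bullet> v = 0" using False xw by (simp_all add: v_def)
      obtain f where f: "orthogonal_transformation f" "f e1 = x"
        using orthogonal_transformation_exists_1[of e1 x] e x by auto
      have fe2: "norm (f e2) = norm v" "x \<bullet> f e2 = x \<bullet> v"
        using f e v by (auto simp: orthogonal_transformation_norm orthogonal_transformation_def)
      \<comment> \<open>A reflection corrects the second vector; it fixes \<open>x\<close>, which is orthogonal to both \<open>f e2\<close> and \<open>v\<close>.\<close>
      obtain g where g: "orthogonal_transformation g" "g (f e2) = v" "g x = x"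
        using reflection_exists[OF fe2(1)] fe2(2) by metis
      have gf: "orthogonal_transformation (g \<circ> f)"
        using f g by (intro orthogonal_transformation_compose)
      have gfi: "(g \<circ> f) y \<bullet> x = y \<bullet> e1" "(g \<circ> f) y \<bullet> w = norm w * (y \<bullet> e2)" for y
      proof -
        have "(g \<circ> f) y \<bullet> (g \<circ> f) e1 = y \<bullet> e1" "(g \<circ> f) y \<bullet> (g \<circ> f) e2 = y \<bullet> e2"
          using gf unfolding orthogonal_transformation_def by blast+
        then show "(g \<circ> f) y \<bullet> x = y \<bullet> e1" and "(g \<circ> f) y \<bullet> w = norm w * (y \<bullet> e2)"
          using False by (simp_all add: f g v_def field_simps)
      qed
      have "(LINT y|S2. h (y \<bullet> x) * (y \<bullet> w) ^ l)
        = (LINT y|S2. h ((g \<circ> f) y \<bullet> x) * ((g \<circ> f) y \<bullet> w) ^ l)"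
        by (rule integral_S2_rotation[symmetric, OF gf continuous_on_zonal_moment[OF x h]])
      also have "\<dots> = (LINT y|S2. norm w ^ l * (h (y \<bullet> e1) * (y \<bullet> e2) ^ l))"
        unfolding gfi by (simp add: power_mult_distrib algebra_simps)
      finally show ?thesis by (simp add: c_def)
    qed
    then show "(LINT y|S2. h (y \<bullet> x) * (y \<bullet> w) ^ l) = (if even l then c * (w \<bullet> w) ^ (l div 2) else 0)"
      using pw odd by auto
  qed
qed

lemma poly_space_inner_power_mult:
  "(\<lambda>x. (x \<bullet> z) ^ j * (r - (x \<bullet> z)\<^sup>2) ^ l) \<in> poly_space (j + 2 * l)"
proof (induction l)
  case (Suc l)
  let ?q = "\<lambda>x. (x \<bullet> z) ^ j * (r - (x \<bullet> z)\<^sup>2) ^ l"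
  have 1: "(\<lambda>x. r * ?q x) \<in> poly_space (Suc (Suc (j + 2 * l)))"
    by (rule poly_space_cmult, rule poly_space_mono[OF Suc]) simp
  have 2: "(\<lambda>x. (-1) * ((x \<bullet> z) * ((x \<bullet> z) * ?q x))) \<in> poly_space (Suc (Suc (j + 2 * l)))"
    by (rule poly_space_cmult, rule poly_space_mult_inner, rule poly_space_mult_inner, rule Suc)
  have "(\<lambda>x. (x \<bullet> z) ^ j * (r - (x \<bullet> z)\<^sup>2) ^ Suc l)
      = (\<lambda>x. r * ?q x + (-1) * ((x \<bullet> z) * ((x \<bullet> z) * ?q x)))"
    by (simp add: algebra_simps power2_eq_square)
  then show ?case using poly_space_add[OF 1 2] by simp
qed (simp add: poly_space_inner_power)

text \<open>A weak form of the Funk-Hecke formula: convolution with a zonal kernel does not raise the degree.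
  Split \<open>z = (x \<bullet> z) x + w\<close> with \<open>w\<close> orthogonal to \<open>x\<close> and expand \<open>(y \<bullet> z)\<^sup>k\<close>. Only even powers of
  \<open>y \<bullet> w\<close> survive the integration, and they contribute powers of \<open>\<bar>w\<bar>\<^sup>2 = \<bar>z\<bar>\<^sup>2 - (x \<bullet> z)\<^sup>2\<close>,
  which are polynomials in \<open>x\<close> of the right degree.\<close>

lemma zonal_convolution_power:
  fixes h :: "real \<Rightarrow> real" and z :: "real^3"
  assumes h: "continuous_on {-1..1} h"
  obtains P where "P \<in> poly_space k"
    "\<And>x. norm x = 1 \<Longrightarrow> (LINT y|S2. h (y \<bullet> x) * (y \<bullet> z) ^ k) = P x"
proof -
  have hp: "continuous_on {-1..1} (\<lambda>t. h t * t ^ j)" for j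
    by (intro continuous_intros h)
  have "\<exists>c. \<forall>x w :: real^3. norm x = 1 \<longrightarrow> x \<bullet> w = 0 \<longrightarrow>
    (LINT y|S2. (h (y \<bullet> x) * (y \<bullet> x) ^ j) * (y \<bullet> w) ^ (k - j))
      = (if even (k - j) then c * (w \<bullet> w) ^ ((k - j) div 2) else 0)" for j
    by (rule zonal_moment[OF hp, of j "k - j"]) blast
  then have "\<exists>c. \<forall>j. \<forall>x w :: real^3. norm x = 1 \<longrightarrow> x \<bullet> w = 0 \<longrightarrow>
    (LINT y|S2. (h (y \<bullet> x) * (y \<bullet> x) ^ j) * (y \<bullet> w) ^ (k - j))
      = (if even (k - j) then c j * (w \<bullet> w) ^ ((k - j) div 2) else 0)"
    by (intro choice allI)
  then obtain c where c: "(LINT y|S2. (h (y \<bullet> x) * (y \<bullet> x) ^ j) * (y \<bullet> w) ^ (k - j))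
      = (if even (k - j) then c j * (w \<bullet> w) ^ ((k - j) div 2) else 0)"
    if "norm x = 1" "x \<bullet> w = 0" for j and x w :: "real^3"
    by blast
  define q where "q j x = (if even (k - j) then c j else 0) *
      ((x \<bullet> z) ^ j * (z \<bullet> z - (x \<bullet> z)\<^sup>2) ^ ((k - j) div 2))" for j and x :: "real^3"
  show ?thesis
  proof
    have q: "q j \<in> poly_space k" if "j \<le> k" for j
      unfolding q_def
      by (rule poly_space_cmult, rule poly_space_mono[OF poly_space_inner_power_mult])
        (use that in presburger)
    show "(\<lambda>x. \<Sum>j\<le>k. real (k choose j) * q j x) \<in> poly_space k"
      by (rule poly_space_sum, rule poly_space_cmult, rule q) simp
    fix x :: "real^3" assume x: "norm x = 1"
    define w where "w = z - (x \<bullet> z) *\<^sub>R x"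
    have xw: "x \<bullet> w = 0" using x by (simp add: w_def inner_diff_right norm_eq_1)
    have ww: "w \<bullet> w = z \<bullet> z - (x \<bullet> z)\<^sup>2"
      using x by (simp add: w_def inner_simps norm_eq_1 inner_commute[of z x] power2_eq_square)
    have yz: "h (y \<bullet> x) * (y \<bullet> z) ^ k = (\<Sum>j\<le>k. (real (k choose j) * (x \<bullet> z) ^ j) *
        ((h (y \<bullet> x) * (y \<bullet> x) ^ j) * (y \<bullet> w) ^ (k - j)))" for y
    proof -
      have "y \<bullet> z = (x \<bullet> z) * (y \<bullet> x) + y \<bullet> w" by (simp add: w_def inner_simps)
      then have "(y \<bullet> z) ^ k = (\<Sum>j\<le>k. real (k choose j) * ((x \<bullet> z) * (y \<bullet> x)) ^ j * (y \<bullet> w) ^ (k - j))"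
        by (simp only: binomial_ring)
      then show ?thesis
        by (simp add: sum_distrib_left power_mult_distrib mult_ac)
    qed
    have "(LINT y|S2. h (y \<bullet> x) * (y \<bullet> z) ^ k)
      = (LINT y|S2. (\<Sum>j\<le>k. (real (k choose j) * (x \<bullet> z) ^ j) * ((h (y \<bullet> x) * (y \<bullet> x) ^ j) * (y \<bullet> w) ^ (k - j))))"
      by (simp only: yz)
    also have "\<dots> = (\<Sum>j\<le>k. (real (k choose j) * (x \<bullet> z) ^ j) *
        (LINT y|S2. (h (y \<bullet> x) * (y \<bullet> x) ^ j) * (y \<bullet> w) ^ (k - j)))"
      by (simp add: Bochner_Integration.integral_sum integrable_S2_continuous
          continuous_on_zonal_moment[OF x hp])
    also have "\<dots> = (\<Sum>j\<le>k. real (k choose j) * q j x)"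
      unfolding c[OF x xw] q_def ww by (intro sum.cong refl) auto
    finally show "(LINT y|S2. h (y \<bullet> x) * (y \<bullet> z) ^ k) = (\<Sum>j\<le>k. real (k choose j) * q j x)" .
  qed
qed

definition exact_cubature :: "nat \<Rightarrow> nat \<Rightarrow> (nat \<Rightarrow> real^3) \<Rightarrow> (nat \<Rightarrow> real) \<Rightarrow> bool" where
  "exact_cubature m N x \<nu> \<longleftrightarrow>
     (\<forall>i\<in>{1..N}. x i \<in> sphere 0 1 \<and> \<nu> i \<ge> 0) \<and> (\<Sum>i=1..N. \<nu> i) = 1 \<and>
     (\<forall>p\<in>mean_zero_poly_space m. (\<Sum>i=1..N. \<nu> i * p (x i)) = 0)"

lemma exact_cubature_mean:
  assumes cub: "exact_cubature m N x \<nu>" and p: "p \<in> poly_space m"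
  shows "(\<Sum>i=1..N. \<nu> i * p (x i)) = (LINT y|S2. p y) / (4 * pi)"
proof -
  define r where "r = (LINT y|S2. p y) / (4 * pi)"
  have "(\<lambda>y. p y + - r) \<in> poly_space m"
    by (rule poly_space_add[OF p poly_space_const])
  moreover have "(LINT y|S2. p y + - r) = 0"
    using integrable_S2_continuous[OF continuous_on_poly_space[OF p]] by (simp add: r_def)
  ultimately have "(\<lambda>y. p y + - r) \<in> mean_zero_poly_space m"
    by (simp add: mean_zero_poly_space_def)
  moreover have "\<forall>p\<in>mean_zero_poly_space m. (\<Sum>i=1..N. \<nu> i * p (x i)) = 0"
    using cub by (simp add: exact_cubature_def)
  ultimately have "(\<Sum>i=1..N. \<nu> i * (p (x i) + - r)) = 0"
    by (rule bspec[rotated])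
  moreover have "(\<Sum>i=1..N. \<nu> i * (p (x i) + - r)) = (\<Sum>i=1..N. \<nu> i * p (x i)) - (\<Sum>i=1..N. \<nu> i) * r"
    by (simp add: right_diff_distrib sum_subtractf sum_distrib_right)
  ultimately show ?thesis using cub by (simp add: exact_cubature_def r_def)
qed

lemma zonal_convolution_mean:
  fixes h :: "real \<Rightarrow> real" and q :: "real^3 \<Rightarrow> real"
  assumes h: "continuous_on {-1..1} h" "h \<in> borel_measurable borel" and q: "continuous_on UNIV q"
  shows "(LINT x|S2. LINT y|S2. h (y \<bullet> x) * q y) = (2 * pi * integral {-1..1} h) * (LINT y|S2. q y)"
proof -
  interpret P: pair_sigma_finite S2 S2 ..
  have id: "(\<lambda>x. x) \<in> measurable S2 borel"
    by (rule measurable_S2_continuous) (rule continuous_on_id)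
  have [measurable]: "q \<in> borel_measurable borel"
    using q by (rule borel_measurable_continuous_onI)
  have [measurable]: "h \<in> borel_measurable borel" by fact
  have f1: "(\<lambda>p. fst p :: real^3) \<in> measurable (S2 \<Otimes>\<^sub>M (S2 :: (real^3) measure)) borel"
    by (rule measurable_compose[OF measurable_fst id])
  have f2: "(\<lambda>p. snd p :: real^3) \<in> measurable ((S2 :: (real^3) measure) \<Otimes>\<^sub>M S2) borel"
    by (rule measurable_compose[OF measurable_snd id])
  note [measurable] = f1 f2
  have "continuous_on (sphere 0 1) q" using q by (rule continuous_on_subset) simp
  then have "bounded (q ` sphere 0 1)" "bounded (h ` {-1..1})"
    by (auto intro!: compact_imp_bounded compact_continuous_image h)
  then obtain B C where "\<forall>t\<in>h ` {-1..1}. norm t \<le> B" "\<forall>t\<in>q ` sphere 0 1. norm t \<le> C"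
    unfolding bounded_iff by blast
  then have B: "\<And>t. t \<in> {-1..1} \<Longrightarrow> \<bar>h t\<bar> \<le> B" and C: "\<And>y. norm y = 1 \<Longrightarrow> \<bar>q y\<bar> \<le> C"
    by auto
  interpret PF: finite_measure "S2 \<Otimes>\<^sub>M S2 :: ((real^3) \<times> (real^3)) measure"
    by (rule finite_measure_pair_measure) unfold_locales
  have int: "integrable (S2 \<Otimes>\<^sub>M S2) (\<lambda>(x, y). h (y \<bullet> x) * q y)"
  proof (rule PF.integrable_const_bound[where B = "B * C"])
    show "AE p in S2 \<Otimes>\<^sub>M S2. norm (case p of (x, y) \<Rightarrow> h (y \<bullet> x) * q y) \<le> B * C"
    proof (rule AE_I2)
      fix p :: "(real^3) \<times> (real^3)" assume "p \<in> space (S2 \<Otimes>\<^sub>M S2)"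
      then obtain x y where p: "p = (x, y)" and "norm x = 1" "norm y = 1"
        by (auto simp: space_pair_measure)
      then have "\<bar>h (y \<bullet> x)\<bar> * \<bar>q y\<bar> \<le> B * C"
        using B C zonal_range[of y x] by (intro mult_mono) (auto intro: order_trans[OF abs_ge_zero])
      then show "norm (case p of (x, y) \<Rightarrow> h (y \<bullet> x) * q y) \<le> B * C" by (simp add: p abs_mult)
    qed
    show "(\<lambda>(x, y). h (y \<bullet> x) * q y) \<in> borel_measurable (S2 \<Otimes>\<^sub>M S2)"
      by (simp add: case_prod_beta) measurable
  qed
  have "(LINT x|S2. LINT y|S2. h (y \<bullet> x) * q y) = (LINT y|S2. LINT x|S2. h (y \<bullet> x) * q y)"
    by (rule P.Fubini_integral[symmetric, OF int])
  also have "\<dots> = (LINT y|S2. (2 * pi * integral {-1..1} h) * q y)"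
  proof (rule integral_S2_cong)
    fix y :: "real^3" assume y: "norm y = 1"
    show "(LINT x|S2. h (y \<bullet> x) * q y) = (2 * pi * integral {-1..1} h) * q y"
      using integral_S2_zonal[OF y h(1)] by (simp add: inner_commute)
  qed
  finally show ?thesis by simp
qed

text \<open>This is what makes exact test functions possible. Exchanging sum and integral, the left-hand side is
  the cubature sum of the convolution of \<open>p\<close> with the kernel \<open>h\<close>. The convolution is again a polynomial
  of degree at most \<open>m\<close>, so the cubature sum is its mean, which is a multiple of the mean of \<open>p\<close>
  by Fubini. In particular, a superposition of equal zonal bumps at the nodes of the
  rule, with the weights of the rule, is orthogonal to all polynomials of mean zero and degree at most \<open>m\<close>.\<close>

theorem zonal_sum_cubature:
  fixes h :: "real \<Rightarrow> real"
  assumes cub: "exact_cubature m N x \<nu>"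
    and h: "continuous_on {-1..1} h" "h \<in> borel_measurable borel"
    and p: "p \<in> poly_space m"
  shows "(LINT y|S2. p y * (\<Sum>i=1..N. \<nu> i * h (y \<bullet> x i))) = (integral {-1..1} h / 2) * (LINT y|S2. p y)"
proof -
  define F where "F y = (\<Sum>i=1..N. \<nu> i * h (y \<bullet> x i))" for y
  define \<Lambda> where "\<Lambda> q = (LINT y|S2. q y * F y) - (integral {-1..1} h / 2) * (LINT y|S2. q y)" for q
  have nx: "norm (x i) = 1" if "i \<in> {1..N}" for i
    using cub that by (simp add: exact_cubature_def)
  have contF: "continuous_on (sphere 0 1) F"
    unfolding F_def by (intro continuous_intros continuous_on_zonal h nx)
  have "\<Lambda> p = 0"
  proof (rule linear_functional_vanishes_on_poly_space[OF _ _ _ p])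
    fix q q' :: "real^3 \<Rightarrow> real" assume "continuous_on UNIV q" "continuous_on UNIV q'"
    then have "continuous_on (sphere 0 1) q" "continuous_on (sphere 0 1) q'"
      by (auto intro: continuous_on_subset)
    then show "\<Lambda> (\<lambda>x. q x + q' x) = \<Lambda> q + \<Lambda> q'"
      using contF by (simp add: \<Lambda>_def algebra_simps integrable_S2_continuous continuous_on_mult)
  next
    show "\<Lambda> (\<lambda>x. r * q x) = r * \<Lambda> q" for q r
      by (simp add: \<Lambda>_def algebra_simps)
  next
    fix z :: "real^3" and k assume k: "k \<le> m"
    obtain P where P: "P \<in> poly_space k"
      "\<And>x. norm x = 1 \<Longrightarrow> (LINT y|S2. h (y \<bullet> x) * (y \<bullet> z) ^ k) = P x"
      using zonal_convolution_power[OF h(1)] by blast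
    have "(LINT y|S2. (y \<bullet> z) ^ k * F y) = (LINT y|S2. (\<Sum>i=1..N. \<nu> i * (h (y \<bullet> x i) * (y \<bullet> z) ^ k)))"
      by (simp add: F_def sum_distrib_left algebra_simps)
    also have "\<dots> = (\<Sum>i=1..N. \<nu> i * (LINT y|S2. h (y \<bullet> x i) * (y \<bullet> z) ^ k))"
      by (subst Bochner_Integration.integral_sum)
        (auto intro!: integrable_S2_continuous continuous_on_mult continuous_on_const
          continuous_on_zonal_moment nx h)
    also have "\<dots> = (\<Sum>i=1..N. \<nu> i * P (x i))"
      by (intro sum.cong refl) (simp add: P(2) nx)
    also have "\<dots> = (LINT x|S2. P x) / (4 * pi)"
      by (rule exact_cubature_mean[OF cub poly_space_mono[OF P(1) k]])
    also have "(LINT x|S2. P x) = (LINT x|S2. LINT y|S2. h (y \<bullet> x) * (y \<bullet> z) ^ k)"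
      by (rule integral_S2_cong) (simp add: P(2))
    also have "\<dots> = (2 * pi * integral {-1..1} h) * (LINT y|S2. (y \<bullet> z) ^ k)"
      by (rule zonal_convolution_mean[OF h]) (intro continuous_intros)
    finally show "\<Lambda> (\<lambda>y. (y \<bullet> z) ^ k) = 0" by (simp add: \<Lambda>_def)
  qed
  then show ?thesis by (simp add: \<Lambda>_def F_def)
qed

section \<open>Existence of cubature rules\<close>

text \<open>The rule constructed below is a product rule in spherical coordinates with equally spaced angles. In
  the longitude, equally spaced points integrate trigonometric polynomials of low degree exactly. In the
  colatitude, the density \<open>\<bar>sin s\<bar>\<close> of the area is replaced by a partial sum of its Fourier series, which
  is a positive trigonometric polynomial.\<close>

definition circle_mean :: "nat \<Rightarrow> (real \<Rightarrow> real) \<Rightarrow> real" where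
  "circle_mean n f = (\<Sum>j<n. f (2 * pi * real j / real n)) / real n"

lemma circle_mean_add: "circle_mean n (\<lambda>s. f s + g s) = circle_mean n f + circle_mean n g"
  and circle_mean_cmult: "circle_mean n (\<lambda>s. r * f s) = r * circle_mean n f"
  and circle_mean_sum: "circle_mean n (\<lambda>s. \<Sum>i\<in>I. F i s) = (\<Sum>i\<in>I. circle_mean n (F i))"
  by (simp_all add: circle_mean_def sum.distrib add_divide_distrib sum_distrib_left
      sum_divide_distrib[symmetric] sum.swap[of _ _ I])

lemma circle_mean_const: "n > 0 \<Longrightarrow> circle_mean n (\<lambda>_. r) = r"
  by (simp add: circle_mean_def)

text \<open>Multiplication by \<open>2 sin (\<pi> l / n)\<close> makes the sum telescope.\<close>

lemma circle_mean_cos: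
  assumes l: "0 < l" "l < n"
  shows "circle_mean n (\<lambda>s. cos (real l * (\<alpha> + s))) = 0"
proof -
  define h where "h = pi * l / n"
  define g where "g j = sin (real l * \<alpha> + h * (2 * real j - 1))" for j :: nat
  have h: "0 < h" "h < pi" using l by (simp_all add: h_def divide_less_eq)
  have "2 * sin h * (\<Sum>j<n. cos (real l * (\<alpha> + 2 * pi * j / n))) = (\<Sum>j<n. g (Suc j) - g j)"
    unfolding sum_distrib_left
  proof (intro sum.cong refl)
    fix j
    define t where "t = real l * \<alpha> + h * (2 * real j)"
    have "real l * (\<alpha> + 2 * pi * j / n) = t"
      by (simp add: t_def h_def algebra_simps)
    moreover have "g (Suc j) = sin (t + h)" "g j = sin (t - h)"
      by (simp_all add: g_def t_def algebra_simps)
    ultimately show "2 * sin h * cos (real l * (\<alpha> + 2 * pi * j / n)) = g (Suc j) - g j"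
      by (simp add: sin_add sin_diff)
  qed
  also have "\<dots> = g n - g 0" by (rule sum_lessThan_telescope)
  also have "g n = sin ((real l * \<alpha> - h) + real l * (2 * pi))"
    using l by (simp add: g_def h_def algebra_simps)
  also have "\<dots> = sin (real l * \<alpha> - h)"
    using sin.plus_of_nat[of "real l * \<alpha> - h" l] by simp
  finally have "2 * sin h * (\<Sum>j<n. cos (real l * (\<alpha> + 2 * pi * j / n))) = 0"
    by (simp add: g_def)
  then show ?thesis using sin_gt_zero[OF h] by (simp add: circle_mean_def)
qed

lemma cos_mult_cos_step:
  "cos x * cos (real i * x) = (cos (real (Suc i) * x) + cos (real (if i = 0 then 1 else i - 1) * x)) / 2"
proof (cases i)
  case (Suc k)
  have "cos (real (Suc i) * x) = cos (real i * x + x)" "cos (real k * x) = cos (real i * x - x)"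
    by (simp_all add: Suc algebra_simps)
  then show ?thesis using Suc by (simp add: cos_add cos_diff)
qed simp

text \<open>The factor \<open>cos (i s)\<close> makes the induction on the power possible: a factor \<open>cos\<close> is traded for a
  shift of \<open>i\<close> by one. The same device is used for the quadrature rule below.\<close>

lemma circle_mean_cos_power_cos:
  assumes "k + i < n"
  shows "circle_mean n (\<lambda>s. cos (\<alpha> + s) ^ k * cos (real i * (\<alpha> + s)))
       = circle_mean n (\<lambda>s. cos s ^ k * cos (real i * s))"
  using assms
proof (induction k arbitrary: i)
  case 0
  then show ?case
    using circle_mean_cos[of i n \<alpha>] circle_mean_cos[of i n 0] by (cases "i = 0") simp_all
next
  case (Suc k)
  let ?i' = "if i = 0 then 1 else i - 1"
  have step: "circle_mean n (\<lambda>s. cos (\<beta> + s) ^ Suc k * cos (real i * (\<beta> + s)))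
    = (circle_mean n (\<lambda>s. cos (\<beta> + s) ^ k * cos (real (Suc i) * (\<beta> + s)))
      + circle_mean n (\<lambda>s. cos (\<beta> + s) ^ k * cos (real ?i' * (\<beta> + s)))) / 2" for \<beta>
  proof -
    have "cos (\<beta> + s) ^ Suc k * cos (real i * (\<beta> + s))
      = (1/2) * (cos (\<beta> + s) ^ k * cos (real (Suc i) * (\<beta> + s)) + cos (\<beta> + s) ^ k * cos (real ?i' * (\<beta> + s)))" for s
    proof -
      have "cos (\<beta> + s) ^ Suc k * cos (real i * (\<beta> + s)) = cos (\<beta> + s) ^ k * (cos (\<beta> + s) * cos (real i * (\<beta> + s)))"
        by simp
      moreover have "c * ((A + B) / 2) = (1/2) * (c * A + c * B)" for A B c :: real
        by (simp add: field_simps)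
      ultimately show ?thesis unfolding cos_mult_cos_step by (simp only:)
    qed
    then show ?thesis by (simp only: circle_mean_cmult circle_mean_add)
  qed
  have IH: "circle_mean n (\<lambda>s. cos (\<alpha> + s) ^ k * cos (real j * (\<alpha> + s)))
       = circle_mean n (\<lambda>s. cos (0 + s) ^ k * cos (real j * (0 + s)))" if "j \<le> Suc i" for j
    using Suc.IH[of j] Suc.prems that by simp
  have i': "?i' \<le> Suc i" by (cases i) simp_all
  have "circle_mean n (\<lambda>s. cos (\<alpha> + s) ^ Suc k * cos (real i * (\<alpha> + s)))
       = circle_mean n (\<lambda>s. cos (0 + s) ^ Suc k * cos (real i * (0 + s)))"
    unfolding step IH[OF order_refl] IH[OF i'] ..
  then show ?case by simp
qed

lemma circle_mean_cos_power:
  assumes "k < n"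
  obtains M where "\<And>\<alpha>. circle_mean n (\<lambda>s. cos (\<alpha> + s) ^ k) = M" "odd k \<Longrightarrow> M = 0"
proof (rule that)
  show eq: "circle_mean n (\<lambda>s. cos (\<alpha> + s) ^ k) = circle_mean n (\<lambda>s. cos s ^ k)" for \<alpha>
    using circle_mean_cos_power_cos[of k 0 n \<alpha>] assms by simp
  assume "odd k"
  then have "circle_mean n (\<lambda>s. cos (pi + s) ^ k) = - circle_mean n (\<lambda>s. cos s ^ k)"
    using circle_mean_cmult[of n "-1" "\<lambda>s. cos s ^ k"] by (simp add: cos_add power_minus_odd)
  then show "circle_mean n (\<lambda>s. cos s ^ k) = 0" using eq[of pi] by simp
qed

text \<open>Up to the factor \<open>2 / \<pi>\<close>, this is a partial sum of the Fourier series of \<open>\<bar>sin s\<bar>\<close>.\<close>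

definition fejer_weight :: "nat \<Rightarrow> real \<Rightarrow> real" where
  "fejer_weight J s = 1 - 2 * (\<Sum>j=1..J. cos (2 * real j * s) / (4 * (real j)\<^sup>2 - 1))"

text \<open>The coefficients telescope, and their sum stays below \<open>1 / 2\<close>.\<close>

lemma fejer_weight_pos: "fejer_weight J s > 0"
proof -
  have sq: "4 * (real j)\<^sup>2 - 1 = (2 * real j - 1) * (2 * real j + 1)" for j
    by (simp add: power2_eq_square algebra_simps)
  have "(\<Sum>j=1..J. 1 / (4 * (real j)\<^sup>2 - 1)) = (1 - 1 / (2 * real J + 1)) / 2"
  proof (induction J)
    case (Suc J)
    define a where "a = 2 * real J + 1"
    have a: "a > 0" by (simp add: a_def)
    then have "1 / (a * (a + 2)) = (1 / a - 1 / (a + 2)) / 2"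
      by (simp add: diff_frac_eq)
    moreover have "(1 - p) / 2 + (p - q) / 2 = (1 - q) / 2" for p q :: real
      by (simp add: field_simps)
    ultimately have "(1 - 1 / a) / 2 + 1 / (a * (a + 2)) = (1 - 1 / (a + 2)) / 2"
      by (simp only:)
    then have "(1 - 1 / (2 * real J + 1)) / 2 + 1 / (4 * (real (Suc J))\<^sup>2 - 1) = (1 - 1 / (2 * real (Suc J) + 1)) / 2"
      unfolding sq by (simp add: a_def algebra_simps)
    moreover have "(\<Sum>j=1..Suc J. 1 / (4 * (real j)\<^sup>2 - 1))
      = (\<Sum>j=1..J. 1 / (4 * (real j)\<^sup>2 - 1)) + 1 / (4 * (real (Suc J))\<^sup>2 - 1)"
      by (simp del: of_nat_Suc)
    ultimately show ?case unfolding Suc by (rule trans[rotated])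
  qed simp
  also have "\<dots> < 1 / 2" by simp
  finally have lt: "(\<Sum>j=1..J. 1 / (4 * (real j)\<^sup>2 - 1)) < 1 / 2" .
  have "(\<Sum>j=1..J. cos (2 * real j * s) / (4 * (real j)\<^sup>2 - 1)) \<le> (\<Sum>j=1..J. 1 / (4 * (real j)\<^sup>2 - 1))"
  proof (intro sum_mono divide_right_mono)
    fix j assume "j \<in> {1..J}"
    then have "real j \<ge> 1" by simp
    then have "1 \<le> (real j)\<^sup>2" by (rule one_le_power)
    then show "0 \<le> 4 * (real j)\<^sup>2 - 1" by linarith
  qed simp
  with lt show ?thesis by (simp add: fejer_weight_def)
qed

text \<open>The mean of \<open>cos (k arccos t)\<close>, the Chebyshev polynomial of degree \<open>k\<close>, over \<open>[-1, 1]\<close>. For \<open>k = 1\<close> the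
  second branch applies, so that no division by zero occurs.\<close>

definition cos_moment :: "nat \<Rightarrow> real" where
  "cos_moment k = (if even k then 1 / (1 - (real k)\<^sup>2) else 0)"

lemma circle_mean_cos_mult_cos:
  assumes "i + k < n" "i > 0"
  shows "circle_mean n (\<lambda>s. cos (real i * s) * cos (real k * s)) = (if i = k then 1 / 2 else 0)"
proof -
  define d where "d = (if i \<le> k then k - i else i - k)"
  have d: "cos (real i * s - real k * s) = cos (real d * s)" for s
  proof (cases "i \<le> k")
    case True
    then have "real i * s - real k * s = - (real d * s)" by (simp add: d_def of_nat_diff algebra_simps)
    then show ?thesis by (simp only: cos_minus)
  next
    case False
    then show ?thesis by (simp add: d_def of_nat_diff algebra_simps)
  qed
  have "cos (real i * s) * cos (real k * s) = (1/2) * cos (real (i + k) * (0 + s)) + (1/2) * cos (real d * (0 + s))" for s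
    unfolding add_0_left d[symmetric] by (simp add: cos_add cos_diff algebra_simps)
  then have "circle_mean n (\<lambda>s. cos (real i * s) * cos (real k * s))
      = (1/2) * circle_mean n (\<lambda>s. cos (real (i + k) * (0 + s))) + (1/2) * circle_mean n (\<lambda>s. cos (real d * (0 + s)))"
    by (simp only: circle_mean_add circle_mean_cmult)
  moreover have "circle_mean n (\<lambda>s. cos (real (i + k) * (0 + s))) = 0"
    by (rule circle_mean_cos) (use assms in auto)
  moreover have "circle_mean n (\<lambda>s. cos (real d * (0 + s))) = (if i = k then 1 else 0)"
  proof (cases "i = k")
    case True
    then show ?thesis using assms by (simp add: d_def circle_mean_const)
  next
    case False
    then show ?thesis by (subst circle_mean_cos) (use assms in \<open>auto simp: d_def\<close>)
  qed
  ultimately show ?thesis by (auto split: if_splits)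
qed

lemma circle_mean_fejer_cos:
  assumes "k \<le> J" "2 * J + k < n"
  shows "circle_mean n (\<lambda>s. fejer_weight J s * cos (real k * s)) = cos_moment k"
proof -
  let ?C = "\<lambda>j. circle_mean n (\<lambda>s. cos (real (2 * j) * s) * cos (real k * s))"
  have "(\<lambda>s. fejer_weight J s * cos (real k * s))
    = (\<lambda>s. cos (real k * s) + (-2) * (\<Sum>j=1..J. (1 / (4 * (real j)\<^sup>2 - 1)) * (cos (real (2 * j) * s) * cos (real k * s))))"
    by (simp add: fejer_weight_def sum_distrib_left sum_distrib_right sum_negf algebra_simps)
  then have "circle_mean n (\<lambda>s. fejer_weight J s * cos (real k * s))
    = circle_mean n (\<lambda>s. cos (real k * s)) + (-2) * (\<Sum>j=1..J. (1 / (4 * (real j)\<^sup>2 - 1)) * ?C j)"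
    by (simp only: circle_mean_add circle_mean_cmult circle_mean_sum)
  also have "(\<Sum>j=1..J. (1 / (4 * (real j)\<^sup>2 - 1)) * ?C j)
      = (\<Sum>j=1..J. (1 / (4 * (real j)\<^sup>2 - 1)) * (if 2 * j = k then 1 / 2 else 0))"
    by (intro sum.cong refl arg_cong2[of _ _ _ _ "(*)"] circle_mean_cos_mult_cos) (use assms in auto)
  also have "\<dots> = (\<Sum>j=1..J. if 2 * j = k then 1 / (4 * (real j)\<^sup>2 - 1) / 2 else 0)"
    by (intro sum.cong refl) simp
  also have "\<dots> = (if even k \<and> k > 0 then 1 / ((real k)\<^sup>2 - 1) / 2 else 0)"
  proof (cases "even k \<and> k > 0")
    case True
    then obtain i where i: "k = 2 * i" "i > 0" by auto
    then have "(\<Sum>j=1..J. if 2 * j = k then 1 / (4 * (real j)\<^sup>2 - 1) / 2 else 0)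
      = (\<Sum>j=1..J. if j = i then 1 / (4 * (real i)\<^sup>2 - 1) / 2 else 0)"
      by (intro sum.cong refl) auto
    then show ?thesis using i assms by (simp add: power_mult_distrib)
  next
    case False
    then show ?thesis by (intro trans[OF sum.neutral]) auto
  qed
  also have "circle_mean n (\<lambda>s. cos (real k * s)) = (if k = 0 then 1 else 0)"
    using circle_mean_cos[of k n 0] assms by (simp add: circle_mean_const)
  finally have *: "circle_mean n (\<lambda>s. fejer_weight J s * cos (real k * s)) =
      (if k = 0 then 1 else 0) + - 2 * (if even k \<and> 0 < k then 1 / ((real k)\<^sup>2 - 1) / 2 else 0)" .
  have "- 2 * (r / 2) = - r" for r :: real by simp
  then have "- 2 * (1 / ((real k)\<^sup>2 - 1) / 2) = - (1 / ((real k)\<^sup>2 - 1))" .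
  also have "\<dots> = 1 / (1 - (real k)\<^sup>2)"
    by (metis minus_diff_eq minus_divide_right)
  finally have "- 2 * (1 / ((real k)\<^sup>2 - 1) / 2) = 1 / (1 - (real k)\<^sup>2)" .
  then show ?thesis unfolding * cos_moment_def by (cases "k = 0") (simp_all only: split: if_splits, simp_all)
qed

lemma has_integral_cos_arccos:
  "((\<lambda>t. cos (real k * arccos t)) has_integral 2 * cos_moment k) {-1..1}"
proof (cases "k = 1")
  case True
  have "((\<lambda>t. t ^ 1) has_integral 2 * cos_moment k) {-1..1}"
    using has_integral_power[of 1] True by (simp add: cos_moment_def)
  then show ?thesis
    by (rule has_integral_eq[rotated]) (simp add: True)
next
  case False
  define a b where "a = real k + 1" and "b = real k - 1"
  have ab: "a \<noteq> 0" "b \<noteq> 0" using False by (auto simp: a_def b_def)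
  define \<Phi> where "\<Phi> t = (cos (a * arccos t) / a - cos (b * arccos t) / b) / 2" for t
  have "((\<lambda>t. cos (real k * arccos t)) has_integral (\<Phi> 1 - \<Phi> (-1))) {-1..1}"
  proof (rule fundamental_theorem_of_calculus_interior)
    show "continuous_on {-1..1} \<Phi>"
      unfolding \<Phi>_def using ab by (intro continuous_intros) auto
    fix t :: real assume t: "t \<in> {-1<..<1}"
    define \<theta> where "\<theta> = arccos t"
    have \<theta>: "0 < \<theta>" "\<theta> < pi" using t arccos_lt_bounded[of t] by (auto simp: \<theta>_def)
    have s: "sin \<theta> = sqrt (1 - t\<^sup>2)" using t by (simp add: \<theta>_def sin_arccos)
    have s0: "sin \<theta> > 0" using \<theta> by (rule sin_gt_zero)
    have deriv: "((\<lambda>t. (cos (a * g t) / a - cos (b * g t) / b) / 2) has_real_derivative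
        (sin (b * g t) - sin (a * g t)) / 2 * d) (at t)"
      if "(g has_real_derivative d) (at t)" for g d
      using ab by (auto intro!: derivative_eq_intros that simp: field_simps)
    have "(arccos has_real_derivative inverse (- sin \<theta>)) (at t)"
      unfolding s using t by (intro DERIV_arccos) auto
    from deriv[OF this] have "(\<Phi> has_real_derivative ((sin (a * \<theta>) - sin (b * \<theta>)) / (2 * sin \<theta>))) (at t)"
      unfolding \<Phi>_def \<theta>_def[symmetric] using s0
      by (elim DERIV_cong) (simp add: divide_simps)
    also have "sin (a * \<theta>) - sin (b * \<theta>) = 2 * sin \<theta> * cos (real k * \<theta>)"
      by (simp add: a_def b_def distrib_right left_diff_distrib sin_add sin_diff)
    finally show "(\<Phi> has_vector_derivative cos (real k * arccos t)) (at t)"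
      using s0 by (simp add: \<theta>_def has_real_derivative_iff_has_vector_derivative[symmetric])
  qed simp
  moreover have "\<Phi> 1 - \<Phi> (-1) = 2 * cos_moment k"
  proof -
    have c: "cos (a * pi) = - ((-1) ^ k)" "cos (b * pi) = - ((-1) ^ k)"
      by (simp_all add: a_def b_def distrib_right left_diff_distrib cos_add cos_diff)
    have ab': "1 / a - 1 / b = 2 * (1 / (1 - (real k)\<^sup>2))"
    proof -
      have "a * b = - (1 - (real k)\<^sup>2)" "b - a = - 2"
        by (simp_all add: a_def b_def power2_eq_square algebra_simps)
      moreover have "1 / a - 1 / b = (b - a) / (a * b)"
        using ab by (simp add: diff_frac_eq)
      ultimately have "1 / a - 1 / b = (- 2) / (- (1 - (real k)\<^sup>2))"
        by (simp only:)
      then show ?thesis by (simp only: minus_divide_divide times_divide_eq_right mult_1_right)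
    qed
    have "\<Phi> 1 - \<Phi> (-1) = (1 / a - 1 / b) * (1 + (-1) ^ k) / 2"
    proof -
      have "\<Phi> 1 = (1 / a - 1 / b) / 2" by (simp add: \<Phi>_def)
      moreover have "\<Phi> (-1) = (- ((-1) ^ k) * (1 / a) - - ((-1) ^ k) * (1 / b)) / 2"
        unfolding \<Phi>_def arccos_minus_1 c by simp
      moreover have "(p - q) / 2 - (- e * p - - e * q) / 2 = (p - q) * (1 + e) / 2" for p q e :: real
        by (simp add: algebra_simps add_divide_distrib diff_divide_distrib)
      ultimately show ?thesis by (simp only:)
    qed
    moreover have "2 * r * (1 + (-1) ^ k) / 2 = (if even k then 2 * r else 0)" for r :: real
      by simp
    ultimately have "\<Phi> 1 - \<Phi> (-1) = (if even k then 2 * (1 / (1 - (real k)\<^sup>2)) else 0)"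
      unfolding ab' by (simp only:)
    then show ?thesis by (simp add: cos_moment_def)
  qed
  ultimately show ?thesis by simp
qed

text \<open>By linearity it is enough to treat the Chebyshev polynomials \<open>cos (i arccos t)\<close>, where both sides are
  \<open>2 cos_moment i\<close>. Factors \<open>t\<close> and \<open>1 - t\<^sup>2\<close> are removed one at a time, a factor \<open>t\<close> at the cost of changing \<open>i\<close> by one.\<close>

lemma fejer_quadrature:
  assumes "k + i + 2 * l \<le> J" "3 * J < n"
  shows "2 * circle_mean n (\<lambda>s. fejer_weight J s * (cos s ^ k * cos (real i * s) * (1 - (cos s)\<^sup>2) ^ l))
     = integral {-1..1} (\<lambda>t. t ^ k * cos (real i * arccos t) * (1 - t\<^sup>2) ^ l)"
  using assms(1)
proof (induction "k + 3 * l" arbitrary: k i l rule: less_induct)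
  case less
  have int: "(\<lambda>t. t ^ k * cos (real i * arccos t) * (1 - t\<^sup>2) ^ l) integrable_on {-1..1}" for k i l
    by (intro integrable_continuous_real continuous_intros) auto
  show ?case
  proof (cases l)
    case (Suc l')
    have L: "circle_mean n (\<lambda>s. fejer_weight J s * (cos s ^ k * cos (real i * s) * (1 - (cos s)\<^sup>2) ^ l))
      = circle_mean n (\<lambda>s. fejer_weight J s * (cos s ^ k * cos (real i * s) * (1 - (cos s)\<^sup>2) ^ l'))
        + (-1) * circle_mean n (\<lambda>s. fejer_weight J s * (cos s ^ (k + 2) * cos (real i * s) * (1 - (cos s)\<^sup>2) ^ l'))"
      unfolding circle_mean_add[symmetric] circle_mean_cmult[symmetric]
      by (simp add: Suc algebra_simps power2_eq_square)
    have "integral {-1..1} (\<lambda>t. t ^ k * cos (real i * arccos t) * (1 - t\<^sup>2) ^ l)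
      = integral {-1..1} (\<lambda>t. t ^ k * cos (real i * arccos t) * (1 - t\<^sup>2) ^ l'
          - t ^ (k + 2) * cos (real i * arccos t) * (1 - t\<^sup>2) ^ l')"
      by (simp add: Suc algebra_simps power2_eq_square)
    also have "\<dots> = integral {-1..1} (\<lambda>t. t ^ k * cos (real i * arccos t) * (1 - t\<^sup>2) ^ l')
        - integral {-1..1} (\<lambda>t. t ^ (k + 2) * cos (real i * arccos t) * (1 - t\<^sup>2) ^ l')"
      by (rule integral_diff[OF int int])
    finally show ?thesis
      using less.hyps[of k l' i] less.hyps[of "k + 2" l' i] less.prems Suc unfolding L by simp
  next
    case l: 0
    show ?thesis
    proof (cases k)
      case 0
      then show ?thesis
        using circle_mean_fejer_cos[of i J n] integral_unique[OF has_integral_cos_arccos[of i]] less.prems assms(2) l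
        by simp
    next
      case (Suc k')
      let ?i' = "if i = 0 then 1 else i - 1"
      have step: "c ^ k * cos (real i * \<theta>) = (1/2) * (c ^ k' * cos (real (Suc i) * \<theta>)) + (1/2) * (c ^ k' * cos (real ?i' * \<theta>))"
        if "cos \<theta> = c" for c \<theta>
      proof -
        have "c ^ k * cos (real i * \<theta>) = c ^ k' * (cos \<theta> * cos (real i * \<theta>))"
          by (simp add: Suc that)
        moreover have "C * ((A + B) / 2) = (1/2) * (C * A) + (1/2) * (C * B)" for A B C :: real
          by (simp add: field_simps)
        ultimately show ?thesis unfolding cos_mult_cos_step by (simp only:)
      qed
      have int': "(\<lambda>t. t ^ k * cos (real i * arccos t)) integrable_on {-1..1}" for k i
        using int[of k i 0] by simp
      have L: "circle_mean n (\<lambda>s. fejer_weight J s * (cos s ^ k * cos (real i * s)))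
        = (1/2) * circle_mean n (\<lambda>s. fejer_weight J s * (cos s ^ k' * cos (real (Suc i) * s)))
          + (1/2) * circle_mean n (\<lambda>s. fejer_weight J s * (cos s ^ k' * cos (real ?i' * s)))"
        unfolding circle_mean_add[symmetric] circle_mean_cmult[symmetric] step[OF refl]
        by (simp only: distrib_left mult.left_commute[of _ "1/2"])
      have "integral {-1..1} (\<lambda>t. t ^ k * cos (real i * arccos t))
        = integral {-1..1} (\<lambda>t. (1/2) * (t ^ k' * cos (real (Suc i) * arccos t)) + (1/2) * (t ^ k' * cos (real ?i' * arccos t)))"
        by (rule integral_cong) (rule step, simp)
      also have "\<dots> = (1/2) * integral {-1..1} (\<lambda>t. t ^ k' * cos (real (Suc i) * arccos t))
          + (1/2) * integral {-1..1} (\<lambda>t. t ^ k' * cos (real ?i' * arccos t))"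
        unfolding integral_mult_right[symmetric]
        by (intro integral_add integrable_on_mult_right int')
      finally have I: "integral {-1..1} (\<lambda>t. t ^ k * cos (real i * arccos t))
        = (1/2) * integral {-1..1} (\<lambda>t. t ^ k' * cos (real (Suc i) * arccos t))
          + (1/2) * integral {-1..1} (\<lambda>t. t ^ k' * cos (real ?i' * arccos t))" .
      have IH: "2 * circle_mean n (\<lambda>s. fejer_weight J s * (cos s ^ k' * cos (real j * s)))
        = integral {-1..1} (\<lambda>t. t ^ k' * cos (real j * arccos t))" if "j \<le> Suc i" for j
        using less.hyps[of k' 0 j] less.prems Suc l that by simp
      have i': "?i' \<le> Suc i" by (cases i) simp_all
      have "2 * (1 / 2 * A + 1 / 2 * B) = 1 / 2 * (2 * A) + 1 / 2 * (2 * B)" for A B :: real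
        by simp
      then show ?thesis
        unfolding l power_0 mult_1_right L I IH[OF order_refl, symmetric] IH[OF i', symmetric] .
    qed
  qed
qed

text \<open>The discrete rotations about the third axis average \<open>(y \<bullet> z)\<^sup>k\<close> to a polynomial in the height \<open>t\<close>, as the
  full circle of rotations would. The coordinate \<open>\<rho>\<close> may be negative, which lets both the nodes of the rule and
  the points of the sphere be treated with the same formula.\<close>

lemma azimuthal_mean_power:
  fixes z :: "real^3"
  assumes "k < n"
  obtains b where "\<And>\<rho> t \<phi>. \<rho>\<^sup>2 + t\<^sup>2 = 1 \<Longrightarrow>
    circle_mean n (\<lambda>s. (vector [\<rho> * cos (\<phi> + s), \<rho> * sin (\<phi> + s), t] \<bullet> z) ^ k)
      = (\<Sum>l | l \<le> k \<and> even l. b l * (t ^ (k - l) * (1 - t\<^sup>2) ^ (l div 2)))"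
proof -
  obtain r \<psi> where z: "z $ 1 = r * cos \<psi>" "z $ 2 = r * sin \<psi>"
    using polar_Ex by blast
  have "\<exists>M. (\<forall>\<alpha>. circle_mean n (\<lambda>s. cos (\<alpha> + s) ^ l) = M) \<and> (odd l \<longrightarrow> M = 0)" if "l \<le> k" for l
    by (rule circle_mean_cos_power[of l n]) (use that assms in auto)
  then obtain M where M: "\<And>l \<alpha>. l \<le> k \<Longrightarrow> circle_mean n (\<lambda>s. cos (\<alpha> + s) ^ l) = M l"
    "\<And>l. l \<le> k \<Longrightarrow> odd l \<Longrightarrow> M l = 0"
    by metis
  define b where "b l = real (k choose l) * r ^ l * z $ 3 ^ (k - l) * M l" for l
  show ?thesis
  proof (rule that[of b])
    fix \<rho> t \<phi> :: real assume "\<rho>\<^sup>2 + t\<^sup>2 = 1"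
    then have \<rho>: "\<rho>\<^sup>2 = 1 - t\<^sup>2" by simp
    have "(vector [\<rho> * cos (\<phi> + s), \<rho> * sin (\<phi> + s), t] \<bullet> z) ^ k
      = (\<Sum>l\<le>k. (real (k choose l) * r ^ l * z $ 3 ^ (k - l) * (\<rho> ^ l * t ^ (k - l))) * cos ((\<phi> - \<psi>) + s) ^ l)" for s
    proof -
      have "cos ((\<phi> - \<psi>) + s) = cos ((\<phi> + s) - \<psi>)" by (simp add: algebra_simps)
      then have "vector [\<rho> * cos (\<phi> + s), \<rho> * sin (\<phi> + s), t] \<bullet> z = \<rho> * r * cos ((\<phi> - \<psi>) + s) + z $ 3 * t"
        by (simp add: inner_vec_def sum_3 z cos_diff distrib_left mult_ac)
      then show ?thesis
        by (simp only: binomial_ring power_mult_distrib mult_ac)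
    qed
    then have "circle_mean n (\<lambda>s. (vector [\<rho> * cos (\<phi> + s), \<rho> * sin (\<phi> + s), t] \<bullet> z) ^ k)
      = (\<Sum>l\<le>k. (real (k choose l) * r ^ l * z $ 3 ^ (k - l) * (\<rho> ^ l * t ^ (k - l))) * circle_mean n (\<lambda>s. cos ((\<phi> - \<psi>) + s) ^ l))"
      by (simp only: circle_mean_sum circle_mean_cmult)
    also have "\<dots> = (\<Sum>l\<le>k. b l * (\<rho> ^ l * t ^ (k - l)))"
      by (intro sum.cong refl) (simp add: b_def M)
    also have "\<dots> = (\<Sum>l | l \<le> k \<and> even l. b l * (t ^ (k - l) * (1 - t\<^sup>2) ^ (l div 2)))"
    proof (rule sum.mono_neutral_cong_right)
      show "\<forall>l\<in>{..k} - {l. l \<le> k \<and> even l}. b l * (\<rho> ^ l * t ^ (k - l)) = 0"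
        by (auto simp: b_def M)
      fix l assume "l \<in> {l. l \<le> k \<and> even l}"
      then have "\<rho> ^ l = (1 - t\<^sup>2) ^ (l div 2)"
        unfolding \<rho>[symmetric] power_mult[symmetric] by simp
      then show "b l * (\<rho> ^ l * t ^ (k - l)) = b l * (t ^ (k - l) * (1 - t\<^sup>2) ^ (l div 2))" by simp
    qed auto
    finally show "circle_mean n (\<lambda>s. (vector [\<rho> * cos (\<phi> + s), \<rho> * sin (\<phi> + s), t] \<bullet> z) ^ k) = \<dots>" .
  qed
qed

definition sphere_point :: "real \<Rightarrow> real \<Rightarrow> real^3" where
  "sphere_point \<theta> \<phi> = vector [sin \<theta> * cos \<phi>, sin \<theta> * sin \<phi>, cos \<theta>]"

lemma norm_sphere_point: "norm (sphere_point \<theta> \<phi>) = 1"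
proof -
  have "sphere_point \<theta> \<phi> \<bullet> sphere_point \<theta> \<phi> = (sin \<theta>)\<^sup>2 * ((cos \<phi>)\<^sup>2 + (sin \<phi>)\<^sup>2) + (cos \<theta>)\<^sup>2"
    by (simp add: sphere_point_def inner_vec_def sum_3 del: sin_cos_squared_add sin_cos_squared_add2) algebra
  then show ?thesis by (simp add: norm_eq_1)
qed

text \<open>Both sides may be averaged over the discrete rotations about the third axis, the right-hand side
  because the area is invariant. This leaves a polynomial in the height, for which the sphere integral is
  given by the hat-box theorem and the sum by the quadrature rule.\<close>

lemma product_rule_power:
  fixes z :: "real^3"
  assumes k: "k \<le> J" and n: "3 * J < n"
  shows "circle_mean n (\<lambda>\<theta>. fejer_weight J \<theta> * circle_mean n (\<lambda>\<phi>. (sphere_point \<theta> \<phi> \<bullet> z) ^ k))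
     = (LINT y|S2. (y \<bullet> z) ^ k) / (4 * pi)"
proof -
  have kn: "k < n" using assms by simp
  obtain b where b: "\<And>\<rho> t \<phi>. \<rho>\<^sup>2 + t\<^sup>2 = 1 \<Longrightarrow>
    circle_mean n (\<lambda>s. (vector [\<rho> * cos (\<phi> + s), \<rho> * sin (\<phi> + s), t] \<bullet> z) ^ k)
      = (\<Sum>l | l \<le> k \<and> even l. b l * (t ^ (k - l) * (1 - t\<^sup>2) ^ (l div 2)))"
    using azimuthal_mean_power[OF kn, of z] by blast
  define q where "q l t = t ^ (k - l) * (1 - t\<^sup>2) ^ (l div 2)" for l and t :: real
  let ?E = "{l. l \<le> k \<and> even l}"
  have contq: "continuous_on S (q l)" for S l
    unfolding q_def by (intro continuous_intros)
  have "circle_mean n (\<lambda>\<phi>. (sphere_point \<theta> \<phi> \<bullet> z) ^ k) = (\<Sum>l\<in>?E. b l * q l (cos \<theta>))" for \<theta>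
    using b[of "sin \<theta>" "cos \<theta>" 0] by (simp add: sphere_point_def q_def)
  then have "circle_mean n (\<lambda>\<theta>. fejer_weight J \<theta> * circle_mean n (\<lambda>\<phi>. (sphere_point \<theta> \<phi> \<bullet> z) ^ k))
    = circle_mean n (\<lambda>\<theta>. \<Sum>l\<in>?E. b l * (fejer_weight J \<theta> * q l (cos \<theta>)))"
    by (simp only: sum_distrib_left mult.left_commute)
  also have "\<dots> = (\<Sum>l\<in>?E. b l * circle_mean n (\<lambda>\<theta>. fejer_weight J \<theta> * q l (cos \<theta>)))"
    by (simp only: circle_mean_sum circle_mean_cmult)
  also have "\<dots> = (\<Sum>l\<in>?E. b l * (integral {-1..1} (q l) / 2))"
  proof (intro sum.cong refl arg_cong2[of _ _ _ _ "(*)"])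
    fix l assume "l \<in> ?E"
    then have "k - l + 0 + 2 * (l div 2) \<le> J" using k by auto
    from fejer_quadrature[OF this n]
    show "circle_mean n (\<lambda>\<theta>. fejer_weight J \<theta> * q l (cos \<theta>)) = integral {-1..1} (q l) / 2"
      by (simp add: q_def[abs_def])
  qed
  finally have L: "circle_mean n (\<lambda>\<theta>. fejer_weight J \<theta> * circle_mean n (\<lambda>\<phi>. (sphere_point \<theta> \<phi> \<bullet> z) ^ k))
    = (\<Sum>l\<in>?E. b l * (integral {-1..1} (q l) / 2))" .
  define e1 e2 e3 :: "real^3" where "e1 = axis 1 1" and "e2 = axis 2 1" and "e3 = axis 3 1"
  have e: "norm e1 = 1" "norm e2 = 1" "e1 \<bullet> e2 = 0" "norm e3 = 1"
    by (simp_all add: e1_def e2_def e3_def inner_axis_axis)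
  have contz: "continuous_on (sphere 0 1) (\<lambda>y. (y \<bullet> z) ^ k)"
    by (intro continuous_intros)
  have contRz: "continuous_on (sphere 0 1) (\<lambda>y. (plane_rotation e1 e2 s y \<bullet> z) ^ k)" for s
    unfolding plane_rotation_def by (intro continuous_intros)
  have "(LINT y|S2. (y \<bullet> z) ^ k) = circle_mean n (\<lambda>s. LINT y|S2. (plane_rotation e1 e2 s y \<bullet> z) ^ k)"
    unfolding integral_S2_rotation[OF orthogonal_plane_rotation[OF e(1-3)] contz]
    using kn by (simp add: circle_mean_const)
  also have "\<dots> = (LINT y|S2. circle_mean n (\<lambda>s. (plane_rotation e1 e2 s y \<bullet> z) ^ k))"
    unfolding circle_mean_def
    by (simp add: Bochner_Integration.integral_sum integrable_S2_continuous contRz)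
  also have "\<dots> = (LINT y|S2. (\<Sum>l\<in>?E. b l * q l (y \<bullet> e3)))"
  proof (rule integral_S2_cong)
    fix y :: "real^3" assume y: "norm y = 1"
    obtain \<rho> \<phi> where y12: "y $ 1 = \<rho> * cos \<phi>" "y $ 2 = \<rho> * sin \<phi>"
      using polar_Ex by blast
    have "y $ 1 * y $ 1 + y $ 2 * y $ 2 + y $ 3 * y $ 3 = 1"
      using y by (simp add: norm_eq_1 inner_vec_def sum_3)
    then have \<rho>: "\<rho>\<^sup>2 + (y $ 3)\<^sup>2 = 1"
      using sin_cos_squared_add[of \<phi>] unfolding y12 by algebra
    have "plane_rotation e1 e2 s y = vector [\<rho> * cos (\<phi> + s), \<rho> * sin (\<phi> + s), y $ 3]" for s
    proof -
      have "y \<bullet> e1 = \<rho> * cos \<phi>" "y \<bullet> e2 = \<rho> * sin \<phi>"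
        by (simp_all add: e1_def e2_def inner_axis y12)
      moreover have "e1 $ 1 = 1" "e1 $ 2 = 0" "e1 $ 3 = 0" "e2 $ 1 = 0" "e2 $ 2 = 1" "e2 $ 3 = 0"
        by (simp_all add: e1_def e2_def axis_def)
      ultimately show ?thesis
        by (simp add: vec_eq_iff forall_3 plane_rotation_def y12 cos_add sin_add algebra_simps)
    qed
    then show "circle_mean n (\<lambda>s. (plane_rotation e1 e2 s y \<bullet> z) ^ k) = (\<Sum>l\<in>?E. b l * q l (y \<bullet> e3))"
      using b[OF \<rho>, of \<phi>] by (simp add: q_def e3_def inner_axis)
  qed
  also have "\<dots> = (\<Sum>l\<in>?E. b l * (2 * pi * integral {-1..1} (q l)))"
    using integral_S2_zonal[OF e(4) contq]
    by (simp add: Bochner_Integration.integral_sum integrable_S2_continuous continuous_on_zonal[OF e(4) contq])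
  finally show ?thesis unfolding L
    by (simp add: sum_divide_distrib)
qed

lemma cubature_sizes_nonempty: "\<exists>N. N \<in> cubature_sizes m"
proof -
  \<comment> \<open>Twice \<open>m\<close> for the frequencies of the weight and once \<open>m\<close> for the polynomial, plus one point.\<close>
  define n where "n = 3 * m + 1"
  have n: "3 * m < n" "n > 0" by (simp_all add: n_def)
  define P where "P = {..<n} \<times> {..<n}"
  define s where "s j = 2 * pi * real j / real n" for j :: nat
  define w where "w = (\<lambda>(i, j::nat). fejer_weight m (s i) / (real n * real n))"
  define X where "X = (\<lambda>(i, j). sphere_point (s i) (s j))"
  define L where "L p = circle_mean n (\<lambda>\<theta>. fejer_weight m \<theta> * circle_mean n (\<lambda>\<phi>. p (sphere_point \<theta> \<phi>)))" for p
  have sum_P: "(\<Sum>c\<in>P. w c * p (X c)) = L p" for p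
    unfolding P_def sum.cartesian_product[symmetric] w_def X_def L_def circle_mean_def s_def
    by (simp add: sum.cartesian_product' sum_distrib_left sum_divide_distrib field_simps)
  have exact: "L p = (LINT y|S2. p y) / (4 * pi)" if p: "p \<in> poly_space m" for p
  proof -
    have "L p - (LINT y|S2. p y) / (4 * pi) = 0"
    proof (rule linear_functional_vanishes_on_poly_space[OF _ _ _ p])
      fix q q' :: "real^3 \<Rightarrow> real" assume "continuous_on UNIV q" "continuous_on UNIV q'"
      then have "continuous_on (sphere 0 1) q" "continuous_on (sphere 0 1) q'"
        by (auto intro: continuous_on_subset)
      then show "L (\<lambda>x. q x + q' x) - (LINT y|S2. q y + q' y) / (4 * pi)
        = (L q - (LINT y|S2. q y) / (4 * pi)) + (L q' - (LINT y|S2. q' y) / (4 * pi))"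
        by (simp add: L_def circle_mean_add distrib_left integrable_S2_continuous add_divide_distrib)
    next
      show "L (\<lambda>x. r * q x) - (LINT y|S2. r * q y) / (4 * pi) = r * (L q - (LINT y|S2. q y) / (4 * pi))" for q r
        by (simp add: L_def circle_mean_cmult mult.left_commute[of _ r] right_diff_distrib)
    next
      show "L (\<lambda>y. (y \<bullet> z) ^ k) - (LINT y|S2. (y \<bullet> z) ^ k) / (4 * pi) = 0" if "k \<le> m" for z k
        unfolding L_def product_rule_power[OF that n(1)] by simp
    qed
    then show ?thesis by simp
  qed
  define N where "N = card P"
  have "finite P" by (simp add: P_def)
  then obtain f where f: "bij_betw f {1..N} P"
    using ex_bij_betw_nat_finite_1 unfolding N_def by blast
  have sum_f: "(\<Sum>i=1..N. g (f i)) = (\<Sum>c\<in>P. g c)" for g :: "nat \<times> nat \<Rightarrow> real"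
    by (rule sum.reindex_bij_betw[OF f])
  have "N \<in> cubature_sizes m"
    unfolding cubature_sizes_def mem_Collect_eq
  proof (intro conjI exI[of _ "X \<circ> f"] exI[of _ "w \<circ> f"] ballI)
    show "N \<ge> 1" using n by (simp add: N_def P_def)
    show "(X \<circ> f) i \<in> sphere 0 1" "(w \<circ> f) i \<ge> 0" for i
      using less_imp_le[OF fejer_weight_pos] by (simp_all add: X_def w_def norm_sphere_point case_prod_beta)
    show "(\<Sum>i=1..N. (w \<circ> f) i) = 1"
      using sum_f[of w] sum_P[of "\<lambda>_. 1"] exact[OF poly_space_const, of 1] by simp
    fix p assume "p \<in> mean_zero_poly_space m"
    then show "(\<Sum>i=1..N. (w \<circ> f) i * p ((X \<circ> f) i)) = 0"
      using sum_f[of "\<lambda>c. w c * p (X c)"] sum_P[of p] exact[of p] by (simp add: mean_zero_poly_space_def)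
  qed
  then show ?thesis ..
qed

section \<open>Concentrating test functions\<close>

text \<open>As a function of \<open>t = y \<bullet> e\<close> this is, up to a constant factor, the conformal factor of a dilation of
  the sphere towards \<open>e\<close>; it concentrates at \<open>e\<close> as \<open>d\<close> tends to zero. Half its logarithm, made
  mean-free, is an extremal of the Onofri inequality.\<close>

definition bump :: "real \<Rightarrow> real \<Rightarrow> real" where
  "bump d t = 1 / (d + 1 - t)\<^sup>2"

lemma continuous_on_bump: "d > 0 \<Longrightarrow> continuous_on {-1..1} (bump d)"
  unfolding bump_def by (intro continuous_intros) auto

lemma has_derivative_bump:
  assumes "d + 1 - t \<noteq> 0"
  shows "(bump d has_real_derivative 2 * bump d t / (d + 1 - t)) (at t within A)"
proof -
  have inv_square: "((\<lambda>t. 1 / (g t)\<^sup>2) has_real_derivative - 2 * D * (1 / (g t)\<^sup>2) / g t) (at t within A)"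
    if "(g has_real_derivative D) (at t within A)" "g t \<noteq> 0" for g D
    using that(2) by (auto intro!: derivative_eq_intros that(1) simp: field_simps power2_eq_square)
  have "((\<lambda>t. d + 1 - t) has_real_derivative - 1) (at t within A)"
    by (auto intro!: derivative_eq_intros)
  from inv_square[OF this assms] show ?thesis by (simp add: bump_def[abs_def])
qed

lemma integral_bump:
  assumes "d > 0"
  shows "integral {-1..1} (bump d) = 1 / d - 1 / (d + 2)"
proof -
  have "(bump d has_integral (1 / (d + 1 - 1) - 1 / (d + 1 - (-1)))) {-1..1}"
  proof (rule fundamental_theorem_of_calculus)
    fix t :: real assume t: "t \<in> {-1..1}"
    then have "d + 1 - t \<noteq> 0" using assms by auto
    then show "((\<lambda>t. 1 / (d + 1 - t)) has_vector_derivative bump d t) (at t within {-1..1})"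
      unfolding has_real_derivative_iff_has_vector_derivative[symmetric] bump_def
      by (auto intro!: derivative_eq_intros simp: power2_eq_square)
  qed simp
  from integral_unique[OF this] show ?thesis by (simp add: add.commute)
qed

lemma integral_inverse_shift:
  fixes d :: real
  assumes "d > 0"
  shows "integral {-1..1} (\<lambda>t. 1 / (d + 1 - t)) = ln (d + 2) - ln d"
proof -
  define \<Phi> where "\<Phi> t = - ln (d + 1 - t)" for t
  have "((\<lambda>t. 1 / (d + 1 - t)) has_integral (\<Phi> 1 - \<Phi> (-1))) {-1..1}"
  proof (rule fundamental_theorem_of_calculus)
    fix t :: real assume t: "t \<in> {-1..1}"
    then have "d + 1 - t > 0" using assms by auto
    then show "(\<Phi> has_vector_derivative 1 / (d + 1 - t)) (at t within {-1..1})"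
      unfolding has_real_derivative_iff_has_vector_derivative[symmetric] \<Phi>_def
      by (auto intro!: derivative_eq_intros)
  qed simp
  from integral_unique[OF this] show ?thesis by (simp add: \<Phi>_def add.commute)
qed

lemma integral_ln_shift_ge:
  fixes d :: real
  assumes "d > 0"
  shows "integral {-1..1} (\<lambda>t. ln (d + 1 - t)) \<ge> - 2"
proof -
  define \<Phi> where "\<Phi> t = (d + 1 - t) - (d + 1 - t) * ln (d + 1 - t)" for t
  have "((\<lambda>t. ln (d + 1 - t)) has_integral (\<Phi> 1 - \<Phi> (-1))) {-1..1}"
  proof (rule fundamental_theorem_of_calculus)
    fix t :: real assume t: "t \<in> {-1..1}"
    then have "d + 1 - t > 0" using assms by auto
    then show "(\<Phi> has_vector_derivative ln (d + 1 - t)) (at t within {-1..1})"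
      unfolding has_real_derivative_iff_has_vector_derivative[symmetric] \<Phi>_def
      by (auto intro!: derivative_eq_intros)
  qed simp
  then have "integral {-1..1} (\<lambda>t. ln (d + 1 - t)) = \<Phi> 1 - \<Phi> (-1)"
    by (rule integral_unique)
  also have "\<dots> = - 2 - d * ln d + (d + 2) * ln (d + 2)"
    by (simp add: \<Phi>_def algebra_simps)
  also have "\<dots> \<ge> - 2"
  proof -
    have "d * ln d \<le> d * ln (d + 2)" using assms by (intro mult_left_mono) auto
    also have "\<dots> \<le> (d + 2) * ln (d + 2)" using assms by (intro mult_right_mono) auto
    finally show ?thesis by simp
  qed
  finally show ?thesis .
qed

definition bump_sum :: "nat \<Rightarrow> (nat \<Rightarrow> 'a::real_inner) \<Rightarrow> (nat \<Rightarrow> real) \<Rightarrow> real \<Rightarrow> 'a \<Rightarrow> real" where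
  "bump_sum N x \<nu> d y = (\<Sum>i=1..N. \<nu> i * bump d (y \<bullet> x i))"

locale cubature =
  fixes m N :: nat and x :: "nat \<Rightarrow> real^3" and \<nu> :: "nat \<Rightarrow> real"
  assumes exact: "exact_cubature m N x \<nu>"
begin

lemma norm_node: "i \<in> {1..N} \<Longrightarrow> norm (x i) = 1"
  and weight_nonneg: "i \<in> {1..N} \<Longrightarrow> \<nu> i \<ge> 0"
  and sum_weights: "(\<Sum>i=1..N. \<nu> i) = 1"
  using exact by (simp_all add: exact_cubature_def)

lemma gap_bounds:
  assumes "norm y = 1" "i \<in> {1..N}"
  shows "d \<le> d + 1 - y \<bullet> x i" "d + 1 - y \<bullet> x i \<le> d + 2"
  using zonal_range[OF assms(1) norm_node[OF assms(2)]] by auto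

lemma bump_sum_pos:
  assumes d: "d > 0" and y: "norm y = 1"
  shows "bump_sum N x \<nu> d y > 0"
proof -
  have "(\<Sum>i=1..N. \<nu> i * (1 / (d + 2)\<^sup>2)) \<le> bump_sum N x \<nu> d y"
    unfolding bump_sum_def
  proof (intro sum_mono mult_left_mono weight_nonneg)
    fix i assume i: "i \<in> {1..N}"
    show "1 / (d + 2)\<^sup>2 \<le> bump d (y \<bullet> x i)"
      unfolding bump_def using gap_bounds[OF y i, of d] d
      by (intro divide_left_mono power_mono mult_pos_pos) auto
  qed
  moreover have "(\<Sum>i=1..N. \<nu> i * (1 / (d + 2)\<^sup>2)) = 1 / (d + 2)\<^sup>2"
    using sum_weights by (simp add: sum_divide_distrib[symmetric])
  moreover have "1 / (d + 2)\<^sup>2 > 0" using d by simp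
  ultimately show ?thesis by linarith
qed

lemma continuous_on_bump_sum: "d > 0 \<Longrightarrow> continuous_on (sphere 0 1) (bump_sum N x \<nu> d)"
  unfolding bump_sum_def[abs_def]
  by (intro continuous_intros continuous_on_zonal norm_node continuous_on_bump)

lemma integral_poly_bump_sum:
  assumes d: "d > 0" and p: "p \<in> poly_space m"
  shows "(LINT y|S2. p y * bump_sum N x \<nu> d y) = ((1 / d - 1 / (d + 2)) / 2) * (LINT y|S2. p y)"
proof -
  have "bump d \<in> borel_measurable borel"
    unfolding bump_def by measurable
  from zonal_sum_cubature[OF exact continuous_on_bump[OF d] this p] show ?thesis
    unfolding bump_sum_def integral_bump[OF d] .
qed

lemma integral_bump_sum_ge:
  assumes d: "0 < d" "d \<le> 1"
  shows "(LINT y|S2. bump_sum N x \<nu> d y) \<ge> 1 / d"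
proof -
  have "(LINT y|S2. bump_sum N x \<nu> d y) = 2 * pi * (1 / d - 1 / (d + 2))"
    using integral_poly_bump_sum[OF d(1) poly_space_const, of 1] by simp
  also have "\<dots> = (4 * pi / (d + 2)) * (1 / d)"
    using d by (simp add: diff_frac_eq)
  also have "\<dots> \<ge> 1 * (1 / d)"
    using d pi_gt3 by (intro mult_right_mono) (auto simp: le_divide_eq)
  finally show ?thesis by simp
qed

text \<open>Each term \<open>9 * bump\<close> is at least one, so that the weighted mean of the bumps is at most the product of
  these terms, and the logarithm of the product is a sum of functions whose integrals are
  bounded uniformly in \<open>d\<close>.\<close>

lemma integral_ln_bump_sum_le:
  assumes d: "0 < d" "d \<le> 1"
  shows "(LINT y|S2. ln (bump_sum N x \<nu> d y)) \<le> real N * (4 * pi * ln 9 + 8 * pi)"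
proof -
  let ?b = "\<lambda>i y. ln 9 - 2 * ln (d + 1 - y \<bullet> x i)"
  have contln: "continuous_on {-1..1} (\<lambda>t. ln (d + 1 - t))"
    using d by (intro continuous_intros) auto
  have contb: "continuous_on (sphere 0 1) (?b i)" if "i \<in> {1..N}" for i
    by (intro continuous_on_diff continuous_on_mult continuous_on_const
        continuous_on_zonal[OF norm_node[OF that] contln])
  have "(LINT y|S2. ln (bump_sum N x \<nu> d y)) \<le> (LINT y|S2. (\<Sum>i=1..N. ?b i y))"
  proof (rule integral_S2_mono)
    show "continuous_on (sphere 0 1) (\<lambda>y. ln (bump_sum N x \<nu> d y))"
      using bump_sum_pos[OF d(1)] by (intro continuous_intros continuous_on_bump_sum d) force
    show "continuous_on (sphere 0 1) (\<lambda>y. \<Sum>i=1..N. ?b i y)"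
      by (intro continuous_on_sum contb)
    fix y :: "real^3" assume y: "norm y = 1"
    have b: "ln (9 * bump d (y \<bullet> x i)) = ?b i y" "1 \<le> 9 * bump d (y \<bullet> x i)" "bump d (y \<bullet> x i) > 0"
      if i: "i \<in> {1..N}" for i
    proof -
      define s where "s = d + 1 - y \<bullet> x i"
      have s: "0 < s" "s \<le> 3" using gap_bounds[OF y i, of d] d by (auto simp: s_def)
      then have "s\<^sup>2 \<le> 3\<^sup>2" by (intro power_mono) auto
      then show "1 \<le> 9 * bump d (y \<bullet> x i)" using s by (simp add: bump_def s_def[symmetric])
      show "bump d (y \<bullet> x i) > 0" using s by (simp add: bump_def s_def[symmetric])
      show "ln (9 * bump d (y \<bullet> x i)) = ?b i y"
        using s by (simp add: bump_def s_def[symmetric] ln_div ln_mult ln_realpow)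
    qed
    have prod: "bump d (y \<bullet> x j) \<le> (\<Prod>i=1..N. 9 * bump d (y \<bullet> x i))" if j: "j \<in> {1..N}" for j
    proof -
      have "9 * bump d (y \<bullet> x j) * 1 \<le> 9 * bump d (y \<bullet> x j) * (\<Prod>i\<in>{1..N} - {j}. 9 * bump d (y \<bullet> x i))"
        using b(2,3) j by (intro mult_left_mono prod_ge_1) (auto intro!: less_imp_le)
      also have "\<dots> = (\<Prod>i=1..N. 9 * bump d (y \<bullet> x i))"
        using j by (simp add: prod.remove[of _ j])
      finally show ?thesis using b(3)[OF j] by linarith
    qed
    have "bump_sum N x \<nu> d y \<le> (\<Sum>j=1..N. \<nu> j * (\<Prod>i=1..N. 9 * bump d (y \<bullet> x i)))"
      unfolding bump_sum_def by (intro sum_mono mult_left_mono prod weight_nonneg)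
    also have "\<dots> = (\<Prod>i=1..N. 9 * bump d (y \<bullet> x i))"
      using sum_weights by (simp add: sum_distrib_right[symmetric])
    finally have "ln (bump_sum N x \<nu> d y) \<le> ln (\<Prod>i=1..N. 9 * bump d (y \<bullet> x i))"
      using bump_sum_pos[OF d(1) y] by (simp only: ln_mono)
    also have "\<dots> = (\<Sum>i=1..N. ln (9 * bump d (y \<bullet> x i)))"
    proof (rule ln_prod)
      show "9 * bump d (y \<bullet> x i) \<noteq> 0" if "i \<in> {1..N}" for i
        using b(3)[OF that] by simp
    qed simp
    also have "\<dots> = (\<Sum>i=1..N. ?b i y)" by (intro sum.cong refl b)
    finally show "ln (bump_sum N x \<nu> d y) \<le> (\<Sum>i=1..N. ?b i y)" .
  qed
  also have "\<dots> = (\<Sum>i=1..N. LINT y|S2. ?b i y)"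
    by (rule Bochner_Integration.integral_sum) (intro integrable_S2_continuous contb)
  also have "\<dots> \<le> (\<Sum>i=1..N. 4 * pi * ln 9 + 8 * pi)"
  proof (rule sum_mono)
    fix i assume i: "i \<in> {1..N}"
    have "(LINT y|S2. ?b i y) = 4 * pi * ln 9 - 2 * (2 * pi * integral {-1..1} (\<lambda>t. ln (d + 1 - t)))"
      using integral_S2_zonal[OF norm_node[OF i] contln] continuous_on_zonal[OF norm_node[OF i] contln]
      by (simp add: integrable_S2_continuous)
    also have "\<dots> \<le> 4 * pi * ln 9 - 2 * (2 * pi * (- 2))"
      using integral_ln_shift_ge[OF d(1)] by (intro diff_left_mono mult_left_mono) auto
    finally show "(LINT y|S2. ?b i y) \<le> 4 * pi * ln 9 + 8 * pi" by simp
  qed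
  finally show ?thesis by simp
qed

text \<open>The gradient in space of half the logarithm of the bump sum.\<close>

definition grad_log :: "real \<Rightarrow> real^3 \<Rightarrow> real^3" where
  "grad_log d y = (\<Sum>i=1..N. (\<nu> i * bump d (y \<bullet> x i) / (d + 1 - y \<bullet> x i)) *\<^sub>R x i) /\<^sub>R bump_sum N x \<nu> d y"

lemma has_derivative_half_ln_bump_sum:
  assumes d: "d > 0" and y: "norm y = 1"
  shows "((\<lambda>y. ln (bump_sum N x \<nu> d y) / 2) has_derivative (\<lambda>h. grad_log d y \<bullet> h)) (at y)"
proof -
  have D: "((\<lambda>y. \<nu> i * bump d (y \<bullet> x i)) has_derivative
      (\<lambda>h. 2 * (\<nu> i * bump d (y \<bullet> x i) / (d + 1 - y \<bullet> x i)) * (h \<bullet> x i))) (at y)"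
    if i: "i \<in> {1..N}" for i
  proof -
    have "d + 1 - y \<bullet> x i \<noteq> 0" using gap_bounds[OF y i, of d] d by linarith
    from has_derivative_bump[OF this, of UNIV] have "(bump d has_derivative
        (\<lambda>r. (2 * bump d (y \<bullet> x i) / (d + 1 - y \<bullet> x i)) * r)) (at (y \<bullet> x i))"
      by (simp only: has_field_derivative_def)
    from has_derivative_compose[OF has_derivative_inner_left[OF has_derivative_ident] this]
    have "((\<lambda>y. bump d (y \<bullet> x i)) has_derivative
        (\<lambda>h. (2 * bump d (y \<bullet> x i) / (d + 1 - y \<bullet> x i)) * (h \<bullet> x i))) (at y)" .
    from has_derivative_mult_right[OF this, of "\<nu> i"] show ?thesis
      by (simp add: mult_ac)
  qed
  have "(bump_sum N x \<nu> d has_derivative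
      (\<lambda>h. \<Sum>i=1..N. 2 * (\<nu> i * bump d (y \<bullet> x i) / (d + 1 - y \<bullet> x i)) * (h \<bullet> x i))) (at y)"
    unfolding bump_sum_def[abs_def] by (intro has_derivative_sum D)
  also have "(\<lambda>h. \<Sum>i=1..N. 2 * (\<nu> i * bump d (y \<bullet> x i) / (d + 1 - y \<bullet> x i)) * (h \<bullet> x i))
      = (\<lambda>h. 2 * bump_sum N x \<nu> d y * (grad_log d y \<bullet> h))"
  proof
    fix h
    have "bump_sum N x \<nu> d y * (grad_log d y \<bullet> h)
        = (\<Sum>i=1..N. (\<nu> i * bump d (y \<bullet> x i) / (d + 1 - y \<bullet> x i)) *\<^sub>R x i) \<bullet> h"
      using bump_sum_pos[OF d y] by (simp add: grad_log_def)
    also have "\<dots> = (\<Sum>i=1..N. (\<nu> i * bump d (y \<bullet> x i) / (d + 1 - y \<bullet> x i)) * (h \<bullet> x i))"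
      by (simp add: inner_sum_left inner_commute[of h])
    finally show "(\<Sum>i=1..N. 2 * (\<nu> i * bump d (y \<bullet> x i) / (d + 1 - y \<bullet> x i)) * (h \<bullet> x i))
        = 2 * bump_sum N x \<nu> d y * (grad_log d y \<bullet> h)"
      by (simp add: sum_distrib_left mult_ac)
  qed
  finally have "(bump_sum N x \<nu> d has_derivative (\<lambda>h. 2 * bump_sum N x \<nu> d y * (grad_log d y \<bullet> h))) (at y)" .
  then show ?thesis
    using bump_sum_pos[OF d y]
    by (auto intro!: derivative_eq_intros simp: fun_eq_iff)
qed

lemma continuous_on_grad_log:
  assumes d: "d > 0"
  shows "continuous_on (sphere 0 1) (grad_log d)"
proof -
  have "continuous_on {-1..1} (\<lambda>t. bump d t / (d + 1 - t))"
    using d by (intro continuous_intros continuous_on_bump) auto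
  then have cont: "continuous_on (sphere 0 1) (\<lambda>y. bump d (y \<bullet> x i) / (d + 1 - y \<bullet> x i))" if "i \<in> {1..N}" for i
    using continuous_on_zonal[OF norm_node[OF that]] by blast
  show ?thesis
    unfolding grad_log_def[abs_def] times_divide_eq_right[symmetric]
  proof (intro continuous_on_scaleR continuous_on_sum continuous_on_mult continuous_on_const cont
      continuous_on_inverse continuous_on_bump_sum[OF d])
    show "\<forall>y\<in>sphere 0 1. bump_sum N x \<nu> d y \<noteq> 0"
      using bump_sum_pos[OF d] by (force simp: less_le)
  qed
qed

text \<open>The tangential gradient of half the logarithm of the sum is a weighted mean of those of the single bumps,
  with the nonnegative weights \<open>\<nu>\<^sub>i bump\<^sub>i / F\<close>. The square of its length is thus at most the maximum, hence at most
  the sum, of the squares for the single bumps. The factor \<open>N\<close> in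
  the theorem comes from this step.\<close>

lemma norm_tangential_gradient_le:
  assumes d: "d > 0" and y: "norm y = 1"
  shows "(norm (grad_log d y - (grad_log d y \<bullet> y) *\<^sub>R y))\<^sup>2 \<le> (\<Sum>i=1..N. 2 / (d + 1 - y \<bullet> x i))"
proof -
  define s where "s i = d + 1 - y \<bullet> x i" for i
  define v where "v i = (x i - (x i \<bullet> y) *\<^sub>R y) /\<^sub>R s i" for i
  define B where "B = (\<Sum>i=1..N. 2 / s i)"
  have s: "s i > 0" if "i \<in> {1..N}" for i
    using gap_bounds[OF y that, of d] d by (simp add: s_def)
  have v: "(norm (v i))\<^sup>2 \<le> 2 / s i" if i: "i \<in> {1..N}" for i
  proof -
    have "(norm (x i - (x i \<bullet> y) *\<^sub>R y))\<^sup>2 = 1 - (y \<bullet> x i)\<^sup>2"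
      using y norm_node[OF i] unfolding power2_norm_eq_inner
      by (simp add: inner_simps norm_eq_1 inner_commute[of y "x i"] power2_eq_square)
    also have "\<dots> = (1 - y \<bullet> x i) * (1 + y \<bullet> x i)" by (simp add: power2_eq_square algebra_simps)
    also have "\<dots> \<le> s i * 2"
      using zonal_range[OF y norm_node[OF i]] d by (intro mult_mono) (auto simp: s_def)
    finally have "(norm (x i - (x i \<bullet> y) *\<^sub>R y))\<^sup>2 / (s i)\<^sup>2 \<le> s i * 2 / (s i)\<^sup>2"
      by (rule divide_right_mono) simp
    moreover have "(norm (v i))\<^sup>2 = (norm (x i - (x i \<bullet> y) *\<^sub>R y))\<^sup>2 / (s i)\<^sup>2"
      unfolding v_def norm_scaleR power_mult_distrib power2_abs power_inverse by (simp only: divide_inverse mult.commute)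
    moreover have "s i * 2 / (s i)\<^sup>2 = 2 / s i"
      using s[OF i] by (simp add: power2_eq_square)
    ultimately show ?thesis by simp
  qed
  have vB: "norm (v i) \<le> sqrt B" if i: "i \<in> {1..N}" for i
  proof (rule real_le_rsqrt)
    have "2 / s i \<le> B"
      unfolding B_def by (rule member_le_sum[OF i]) (use s in \<open>auto intro: less_imp_le\<close>)
    then show "(norm (v i))\<^sup>2 \<le> B" using v[OF i] by linarith
  qed
  define F where "F = bump_sum N x \<nu> d y"
  have F: "F > 0" unfolding F_def by (rule bump_sum_pos[OF d y])
  have "F *\<^sub>R (grad_log d y - (grad_log d y \<bullet> y) *\<^sub>R y) = (\<Sum>i=1..N. (\<nu> i * bump d (y \<bullet> x i)) *\<^sub>R v i)"
  proof -
    have "F *\<^sub>R grad_log d y = (\<Sum>i=1..N. (\<nu> i * bump d (y \<bullet> x i) / s i) *\<^sub>R x i)"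
      using F by (simp add: grad_log_def F_def s_def)
    then have "F *\<^sub>R (grad_log d y - (grad_log d y \<bullet> y) *\<^sub>R y)
      = (\<Sum>i=1..N. (\<nu> i * bump d (y \<bullet> x i) / s i) *\<^sub>R x i) - ((\<Sum>i=1..N. (\<nu> i * bump d (y \<bullet> x i) / s i) *\<^sub>R x i) \<bullet> y) *\<^sub>R y"
      by (metis inner_scaleR_left scaleR_diff_right scaleR_scaleR)
    also have "\<dots> = (\<Sum>i=1..N. (\<nu> i * bump d (y \<bullet> x i)) *\<^sub>R v i)"
      by (simp add: inner_sum_left scaleR_sum_left sum_subtractf[symmetric] v_def scaleR_diff_right divide_inverse mult_ac)
    finally show ?thesis .
  qed
  then have "F * norm (grad_log d y - (grad_log d y \<bullet> y) *\<^sub>R y) = norm (\<Sum>i=1..N. (\<nu> i * bump d (y \<bullet> x i)) *\<^sub>R v i)"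
    using F by (metis abs_of_pos norm_scaleR)
  also have "\<dots> \<le> (\<Sum>i=1..N. norm ((\<nu> i * bump d (y \<bullet> x i)) *\<^sub>R v i))"
    by (rule norm_sum)
  also have "\<dots> \<le> (\<Sum>i=1..N. (\<nu> i * bump d (y \<bullet> x i)) * sqrt B)"
  proof (rule sum_mono)
    fix i assume i: "i \<in> {1..N}"
    have "\<nu> i * bump d (y \<bullet> x i) \<ge> 0"
      using weight_nonneg[OF i] by (simp add: bump_def)
    then show "norm ((\<nu> i * bump d (y \<bullet> x i)) *\<^sub>R v i) \<le> (\<nu> i * bump d (y \<bullet> x i)) * sqrt B"
      using vB[OF i] by (simp add: mult_left_mono del: mult_nonneg_nonneg)
  qed
  also have "\<dots> = F * sqrt B"
    by (simp add: F_def bump_sum_def sum_distrib_right)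
  finally have "norm (grad_log d y - (grad_log d y \<bullet> y) *\<^sub>R y) \<le> sqrt B"
    using F by simp
  then have "(norm (grad_log d y - (grad_log d y \<bullet> y) *\<^sub>R y))\<^sup>2 \<le> (sqrt B)\<^sup>2"
    by (intro power_mono) auto
  also have "(sqrt B)\<^sup>2 = B"
    using s unfolding B_def by (intro real_sqrt_pow2 sum_nonneg) (auto intro: less_imp_le)
  finally show ?thesis by (simp add: B_def s_def)
qed

lemma L2_norm_gradient_le:
  assumes d: "0 < d" "d \<le> 1"
  shows "(L2_norm_S2 (\<lambda>y. grad_log d y - (grad_log d y \<bullet> y) *\<^sub>R y))\<^sup>2 \<le> 4 * pi * real N * (ln 3 + ln (1 / d))"
proof -
  have contd: "continuous_on {-1..1} (\<lambda>t. 1 / (d + 1 - t))"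
    using d by (intro continuous_intros) auto
  have conti: "continuous_on (sphere 0 1) (\<lambda>y. 1 / (d + 1 - y \<bullet> x i))" if "i \<in> {1..N}" for i
    by (rule continuous_on_zonal[OF norm_node[OF that] contd])
  have "(L2_norm_S2 (\<lambda>y. grad_log d y - (grad_log d y \<bullet> y) *\<^sub>R y))\<^sup>2
      = (LINT y|S2. (norm (grad_log d y - (grad_log d y \<bullet> y) *\<^sub>R y))\<^sup>2)"
    unfolding L2_norm_S2_def by (intro real_sqrt_pow2 Bochner_Integration.integral_nonneg) simp
  also have "\<dots> \<le> (LINT y|S2. (\<Sum>i=1..N. 2 * (1 / (d + 1 - y \<bullet> x i))))"
    using norm_tangential_gradient_le[OF d(1)]
    by (intro integral_S2_mono continuous_intros continuous_on_grad_log d conti) auto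
  also have "\<dots> = (\<Sum>i=1..N. 2 * (LINT y|S2. 1 / (d + 1 - y \<bullet> x i)))"
    by (subst Bochner_Integration.integral_sum)
      (auto intro!: integrable_S2_continuous continuous_on_mult continuous_on_const conti[unfolded atLeastAtMost_iff One_nat_def] simp del: times_divide_eq_right)
  also have "\<dots> = (\<Sum>i=1..N. 2 * (2 * pi * (ln (d + 2) - ln d)))"
    using integral_S2_zonal[OF norm_node contd] by (intro sum.cong refl) (simp add: integral_inverse_shift[OF d(1)])
  also have "\<dots> = 4 * pi * real N * (ln (d + 2) + ln (1 / d))"
    using d by (simp add: ln_div)
  also have "\<dots> \<le> 4 * pi * real N * (ln 3 + ln (1 / d))"
    using d by (intro mult_left_mono add_right_mono) auto
  finally show ?thesis .
qed

text \<open>The test function is half the logarithm of the bump sum, minus its mean. Up to terms bounded in \<open>d\<close>,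
  the left-hand side of the inequality is at least \<open>ln (1 / d)\<close> and the energy is
  at most \<open>4 \<pi> N ln (1 / d)\<close>.\<close>

lemma log_inequality_at_bumps:
  fixes a c :: real
  assumes a: "a \<ge> 0" and d: "0 < d" "d \<le> 1"
    and ineq: "\<And>(u :: real^3 \<Rightarrow> real) (G :: real^3 \<Rightarrow> real^3).
      u \<in> H1_S2 \<Longrightarrow> u has_L2_weak_gradient G \<Longrightarrow>
      (LINT x|S2. u x) = 0 \<Longrightarrow>
      (\<forall>p\<in>mean_zero_poly_space m. (LINT x|S2. p x * exp (2 * u x)) = 0) \<Longrightarrow>
      ln (LINT x|S2. exp (2 * u x)) \<le> a * (L2_norm_S2 G)\<^sup>2 + c"
  shows "ln (1 / d) * (1 - 4 * pi * real N * a) \<le> real N * (ln 9 + 2) + 4 * pi * real N * a * ln 3 + c"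
proof -
  define F where "F = bump_sum N x \<nu> d"
  define G where "G y = grad_log d y - (grad_log d y \<bullet> y) *\<^sub>R y" for y
  define M where "M = (LINT y|S2. ln (F y)) / (4 * pi)"
  define u where "u y = ln (F y) / 2 - M / 2" for y
  have Fpos: "F y > 0" if "norm y = 1" for y unfolding F_def by (rule bump_sum_pos[OF d(1) that])
  have contF: "continuous_on (sphere 0 1) F" unfolding F_def by (rule continuous_on_bump_sum[OF d(1)])
  have contlnF: "continuous_on (sphere 0 1) (\<lambda>y. ln (F y))"
    using Fpos by (intro continuous_intros contF) force
  have grad: "u has_L2_weak_gradient G"
    unfolding G_def
  proof (rule has_L2_weak_gradient_smooth)
    show "(u has_derivative (\<lambda>h. grad_log d y \<bullet> h)) (at y)" if "norm y = 1" for y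
      unfolding u_def F_def
      by (rule has_derivative_eq_rhs, rule has_derivative_diff,
          rule has_derivative_half_ln_bump_sum[OF d(1) that], rule has_derivative_const) simp
    show "continuous_on (sphere 0 1) (grad_log d)" by (rule continuous_on_grad_log[OF d(1)])
  qed
  have contu: "continuous_on (sphere 0 1) u"
    unfolding u_def by (intro continuous_intros contlnF) simp
  have H1: "u \<in> H1_S2"
    using grad square_integrable_S2_continuous[OF contu] by (auto simp: H1_S2_def)
  have mean: "(LINT y|S2. u y) = 0"
    using integrable_S2_continuous[OF contlnF] by (simp add: u_def M_def)
  have expu: "exp (2 * u y) = exp (- M) * F y" if "norm y = 1" for y
  proof -
    have "2 * u y = - M + ln (F y)" by (simp add: u_def right_diff_distrib)
    then show ?thesis using Fpos[OF that] by (simp only: exp_add exp_ln)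
  qed
  have orth: "\<forall>p\<in>mean_zero_poly_space m. (LINT y|S2. p y * exp (2 * u y)) = 0"
  proof
    fix p assume p: "p \<in> mean_zero_poly_space m"
    have "(LINT y|S2. p y * exp (2 * u y)) = (LINT y|S2. exp (- M) * (p y * F y))"
      by (rule integral_S2_cong) (simp add: expu)
    then show "(LINT y|S2. p y * exp (2 * u y)) = 0"
      using integral_poly_bump_sum[OF d(1), of p] p by (simp add: F_def mean_zero_poly_space_def)
  qed
  have mass: "(LINT y|S2. F y) \<ge> 1 / d" unfolding F_def by (rule integral_bump_sum_ge[OF d])
  then have pos: "(LINT y|S2. F y) > 0" using d by (meson divide_pos_pos less_le_trans zero_less_one)
  have "(LINT y|S2. exp (2 * u y)) = (LINT y|S2. exp (- M) * F y)"
    by (rule integral_S2_cong) (rule expu)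
  then have "ln (LINT y|S2. exp (2 * u y)) = ln (LINT y|S2. F y) - M"
    using pos by (simp add: ln_mult)
  moreover have "ln (1 / d) \<le> ln (LINT y|S2. F y)"
    using mass pos d by simp
  moreover have "M \<le> real N * (ln 9 + 2)"
    using integral_ln_bump_sum_le[OF d] by (simp add: M_def F_def field_simps)
  moreover have "a * (L2_norm_S2 G)\<^sup>2 \<le> a * (4 * pi * real N * (ln 3 + ln (1 / d)))"
    unfolding G_def by (rule mult_left_mono[OF L2_norm_gradient_le[OF d] a])
  ultimately have "ln (1 / d) - real N * (ln 9 + 2) \<le> a * (4 * pi * real N * (ln 3 + ln (1 / d))) + c"
    using ineq[OF H1 grad mean orth] by linarith
  then show ?thesis by (simp add: algebra_simps)
qed

end

section \<open>The lower bound for the constant\<close>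

theorem lemma3p1:
  fixes m :: nat and a c :: real
  assumes "m \<ge> 1" and "a \<ge> 0"
    and "\<And>(u :: real^3 \<Rightarrow> real) (G :: real^3 \<Rightarrow> real^3).
      u \<in> H1_S2 \<Longrightarrow> u has_L2_weak_gradient G \<Longrightarrow>
      (LINT x|S2. u x) = 0 \<Longrightarrow>
      (\<forall>p\<in>mean_zero_poly_space m. (LINT x|S2. p x * exp (2 * u x)) = 0) \<Longrightarrow>
      ln (LINT x|S2. exp (2 * u x)) \<le> a * (L2_norm_S2 G)\<^sup>2 + c"
  shows "a \<ge> 1 / (4 * pi * real (min_cubature_size m))"
proof -
  define N where "N = min_cubature_size m"
  have "N \<in> cubature_sizes m"
    unfolding N_def min_cubature_size_def using cubature_sizes_nonempty by (rule LeastI_ex)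
  then obtain x \<nu> where N: "N \<ge> 1" and "exact_cubature m N x \<nu>"
    unfolding cubature_sizes_def exact_cubature_def by blast
  then interpret cubature m N x \<nu> by unfold_locales
  define C where "C = real N * (ln 9 + 2) + 4 * pi * real N * a * ln 3 + c"
  define K where "K = 1 - 4 * pi * real N * a"
  have bound: "ln (1 / d) * K \<le> C" if "0 < d" "d \<le> 1" for d
    unfolding K_def C_def by (rule log_inequality_at_bumps[OF assms(2) that assms(3)])
  have "K \<le> 0"
  proof (rule ccontr)
    assume "\<not> K \<le> 0"
    \<comment> \<open>At \<open>d = exp (- L)\<close> the bound would read \<open>\<bar>C\<bar> + 1 \<le> C\<close>.\<close>
    define L where "L = (\<bar>C\<bar> + 1) / K"
    have "L * K \<le> C"
      using bound[of "exp (- L)"] \<open>\<not> K \<le> 0\<close> by (simp add: L_def ln_div)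
    then show False using \<open>\<not> K \<le> 0\<close> by (simp add: L_def)
  qed
  then show ?thesis
    using N by (simp add: K_def N_def[symmetric] divide_le_eq mult_ac)
qed

end
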